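(* Let $1\le k\le l\le n$, let $E\subset\mathbb R^n$ be a $k$-dimensional linear subspace and $F\subset\mathbb R^n$ an $l$-dimensional linear subspace with $E\subseteq F$. Let $K,L\subset\mathbb R^n$ be convex bodies such that $\max_{z\in\mathbb R^n}|P_F(K\cap(z-L))|=|P_F(K\cap(-L))|$. Then $$|(K+L)\cap E|\ \leq\ \binom{l+k}{k}\int_{F\cap E^\perp}\frac{|P_F(K)\cap(x+E)|\,|P_F(-L)\cap(x+E)|}{\max_{z\in\mathbb R^n}|P_F(K\cap(z-L))|}\,dx.$$ In particular, for $L=-K$: for every convex body $K\subset\mathbb R^n$, every $k$-dimensional linear subspace $E$ and every integer $l$ with $k\le l\le n$, $$|(K-K)\cap E|\ \leq\ \binom{l+k}{k}\inf_{F\in G_{n,l},\,E\subseteq F}\ \max_{x\in F}|P_F(K)\cap(x+E)|.$$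
   Context: A convex body in $\mathbb R^n$ is a compact convex set with non-empty interior; $K+L$ is the Minkowski sum, $z-L=\{z-y:y\in L\}$, $K-K=K+(-K)$. $G_{n,l}$ is the set of $l$-dimensional linear subspaces of $\mathbb R^n$; $P_F$ is the orthogonal projection onto $F$; $E^\perp$ is the orthogonal complement. $|\cdot|$ denotes Lebesgue measure of the appropriate dimension: $k$-dimensional for subsets of translates of $E$, $l$-dimensional for subsets of $F$. The integral is with respect to $(l-k)$-dimensional Lebesgue measure on $F\cap E^\perp$ (unit point mass at $0$ if $l=k$). The normalization $\max_z|P_F(K\cap(z-L))|=|P_F(K\cap(-L))|$ is a standing assumption (attained by translating $L$), automatic if $L=-K$. *)

theory Defs
  imports "HOL-Analysis.Analysis"
begin

definition convex_body :: "'a::euclidean_space set \<Rightarrow> bool" where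
  "convex_body K \<longleftrightarrow> compact K \<and> convex K \<and> interior K \<noteq> {}"

definition orth_proj :: "'a::euclidean_space set \<Rightarrow> 'a \<Rightarrow> 'a" where
  "orth_proj F x = (THE y. y \<in> F \<and> x - y \<in> F\<^sup>\<bottom>)"

definition orthonormal_basis :: "'a::euclidean_space set \<Rightarrow> 'a set \<Rightarrow> bool" where
  "orthonormal_basis S B \<longleftrightarrow>
     B \<subseteq> S \<and> span B = S \<and> pairwise orthogonal B \<and> (\<forall>b\<in>B. norm b = 1)"

lemma orthonormal_basis_exists:
  assumes "subspace S"
  shows "\<exists>B. orthonormal_basis S B"
  unfolding orthonormal_basis_def by (metis orthonormal_basis_subspace[OF assms])

(* The Lebesgue measure of dimension dim S on the subspace S, as a Borel measure on the
   whole space that is concentrated on S.  This is the construction of lborel (see lborel_eq)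
   with Basis replaced by an orthonormal basis of S; the choice of the basis is irrelevant
   because Lebesgue measure is invariant under linear isometries.  For S = {0} the basis is
   empty, and the measure is the unit point mass at 0. *)
definition subspace_lborel :: "'a::euclidean_space set \<Rightarrow> 'a measure" where
  "subspace_lborel S =
     (let B = (SOME B. orthonormal_basis S B)
      in distr (\<Pi>\<^sub>M b\<in>B. lborel) borel (\<lambda>f. \<Sum>b\<in>B. f b *\<^sub>R b))"

(* Only meant for subsets of S.  All sets measured in the statement are compact, so
   working with Borel sets and real values loses nothing. *)
definition subspace_volume :: "'a::euclidean_space set \<Rightarrow> 'a set \<Rightarrow> real" where
  "subspace_volume S A = measure (subspace_lborel S) A"

(* Volume of a subset A of the translate x + S, moved back to S. *)
definition flat_volume :: "'a::euclidean_space set \<Rightarrow> 'a \<Rightarrow> 'a set \<Rightarrow> real" where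
  "flat_volume S x A = subspace_volume S ((\<lambda>y. y - x) ` A)"

(* The maximum of f over S in the literal sense (an attained value), not a supremum. *)
definition maximum_over :: "'b set \<Rightarrow> ('b \<Rightarrow> real) \<Rightarrow> real" where
  "maximum_over S f = (GREATEST m. m \<in> f ` S)"

(* |P_F (K \<inter> (z - L))| *)
definition proj_inter_volume ::
  "'a::euclidean_space set \<Rightarrow> 'a set \<Rightarrow> 'a set \<Rightarrow> 'a \<Rightarrow> real" where
  "proj_inter_volume F K L z = subspace_volume F (orth_proj F ` (K \<inter> (\<lambda>y. z - y) ` L))"

(* Pitfall: on sets, - is complement and difference, so reflections are written as images
   under uminus; + on sets is the Minkowski sum of HOL-Library.Set_Algebras. *)

end

theory Submission
  imports Defs "HOL-Probability.Distributions"
begin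

text \<open>
  Put \<open>g(z) = |P\<^sub>F K \<inter> (z - P\<^sub>F L)|\<close> for \<open>z \<in> E\<close>, \<open>M = |P\<^sub>F(K \<inter> (-L))|\<close> and \<open>C = (K + L) \<inter> E\<close>.
  If \<open>c = a + b \<in> C\<close> with \<open>a \<in> K\<close>, \<open>b \<in> L\<close>, then \<open>K \<inter> (tc - L)\<close> contains \<open>(1 - t)(K \<inter> (-L)) + ta\<close>, so
  \<open>g(tc) \<ge> (1 - t)^l M\<close>; no Brunn-Minkowski inequality is needed. Integrating over \<open>E\<close> by layers gives
  \<open>\<integral>\<^sub>E g \<ge> M |C| \<integral>\<^sub>0\<^sup>1 l (1 - t)^(l - 1) t^k dt = M |C| / binom(l + k, k)\<close>. On the other hand, Fubini's
  theorem along \<open>F = E \<oplus> (F \<inter> E\<^sup>\<bottom>)\<close> evaluates \<open>\<integral>\<^sub>E g\<close> as the integral of the product of the slice volumes.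
  For \<open>L = -K\<close> one slice factor is bounded by its maximum and the other integrates to \<open>|P\<^sub>F K| = M\<close>.

  Lebesgue measure on a subspace is handled through uniqueness of invariant measures, normalised by
  the rotation-invariant Gaussian integral. This yields independence of the chosen orthonormal basis,
  the scaling law and the product decomposition.
\<close>

section \<open>Invariant measures on a subspace\<close>

text \<open>The measure lives on the Borel sets of the whole space and is concentrated on
  \<open>S\<close>, so subspaces need no types of their own. Sigma-finiteness provides Tonelli's
  theorem. The zero measure qualifies too, so normalization has to come from elsewhere.\<close>

locale invariant_measure = sigma_finite_measure M
  for M :: "'a::euclidean_space measure" +
  fixes S :: "'a set"
  assumes sets_M [simp, measurable_cong]: "sets M = sets borel"
    and subspace_S: "subspace S"
    and AE_mem: "AE x in M. x \<in> S"
    and translation: "v \<in> S \<Longrightarrow> distr M borel ((+) v) = M"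
    and reflection: "distr M borel uminus = M"
begin

lemma space_M [simp]: "space M = UNIV"
  using sets_eq_imp_space_eq[OF sets_M] by simp

lemma nn_integral_translate:
  assumes [measurable]: "f \<in> borel_measurable borel" and "v \<in> S"
  shows "(\<integral>\<^sup>+x. f (v + x) \<partial>M) = (\<integral>\<^sup>+x. f x \<partial>M)"
proof -
  have "(\<integral>\<^sup>+x. f x \<partial>M) = (\<integral>\<^sup>+x. f x \<partial>distr M borel ((+) v))"
    using translation[OF \<open>v \<in> S\<close>] by simp
  also have "\<dots> = (\<integral>\<^sup>+x. f (v + x) \<partial>M)"
    by (rule nn_integral_distr) measurable
  finally show ?thesis ..
qed

lemma nn_integral_reflect:
  assumes [measurable]: "f \<in> borel_measurable borel"
  shows "(\<integral>\<^sup>+x. f (- x) \<partial>M) = (\<integral>\<^sup>+x. f x \<partial>M)"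
proof -
  have "(\<integral>\<^sup>+x. f x \<partial>M) = (\<integral>\<^sup>+x. f x \<partial>distr M borel uminus)"
    using reflection by simp
  also have "\<dots> = (\<integral>\<^sup>+x. f (- x) \<partial>M)"
    by (rule nn_integral_distr) measurable
  finally show ?thesis ..
qed

lemma nn_integral_translate_reflect:
  assumes [measurable]: "f \<in> borel_measurable borel" and "v \<in> S"
  shows "(\<integral>\<^sup>+x. f (v - x) \<partial>M) = (\<integral>\<^sup>+x. f x \<partial>M)"
  using nn_integral_reflect[of "\<lambda>x. f (v + x)"] nn_integral_translate[of f v] assms by simp

lemma emeasure_translate:
  assumes [measurable]: "A \<in> sets borel" and "v \<in> S"
  shows "emeasure M ((+) v ` A) = emeasure M A"
proof -
  have eq: "(+) v ` A = (+) (- v) -` A"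
    by (auto simp: image_iff) (metis add.left_commute add.right_neutral add_uminus_conv_diff diff_add_cancel)
  have v: "- v \<in> S"
    using \<open>v \<in> S\<close> subspace_S subspace_neg by blast
  have "emeasure M A = emeasure (distr M borel ((+) (- v))) A"
    using translation[OF v] by simp
  also have "\<dots> = emeasure M ((+) v ` A)"
    by (subst emeasure_distr) (auto simp: eq)
  finally show ?thesis ..
qed

text \<open>Concentration on \<open>S\<close> allows slices to be written as preimages of sets in
  the whole space, without intersecting them with \<open>S\<close>.\<close>

lemma emeasure_Int_S:
  assumes [measurable]: "A \<in> sets borel"
  shows "emeasure M (A \<inter> S) = emeasure M A"
proof (rule emeasure_eq_AE)
  have [measurable]: "S \<in> sets borel"
    using closed_subspace[OF subspace_S] by simp
  show "A \<inter> S \<in> sets M" "A \<in> sets M" by simp_all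
  show "AE x in M. (x \<in> A \<inter> S) = (x \<in> A)"
    using AE_mem by eventually_elim auto
qed

end

text \<open>Weil's argument: substituting \<open>y \<mapsto> y - x\<close> and then \<open>x \<mapsto> y - x\<close> in the double
  integral of \<open>f x * g y\<close> exchanges the roles of \<open>f\<close> and \<open>g\<close>.\<close>

lemma invariant_measure_unique:
  assumes M: "invariant_measure M S" and N: "invariant_measure N S"
    and [measurable]: "f \<in> borel_measurable borel" "g \<in> borel_measurable borel"
  shows "(\<integral>\<^sup>+x. f x \<partial>M) * (\<integral>\<^sup>+y. g y \<partial>N) = (\<integral>\<^sup>+y. f y \<partial>N) * (\<integral>\<^sup>+x. g x \<partial>M)"
proof -
  interpret M: invariant_measure M S by fact
  interpret N: invariant_measure N S by fact
  interpret MN: pair_sigma_finite M N ..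
  note M.sets_M[measurable_cong] N.sets_M[measurable_cong]
  have *: "- x \<in> S" if "x \<in> S" for x
    using that M.subspace_S subspace_neg by blast
  have "(\<integral>\<^sup>+x. f x \<partial>M) * (\<integral>\<^sup>+y. g y \<partial>N) = (\<integral>\<^sup>+x. f x * (\<integral>\<^sup>+y. g y \<partial>N) \<partial>M)"
    by (simp add: nn_integral_multc)
  also have "\<dots> = (\<integral>\<^sup>+x. (\<integral>\<^sup>+y. f x * g (y - x) \<partial>N) \<partial>M)"
  \<comment> \<open>The shift by \<open>- x\<close> is available only for \<open>x \<in> S\<close>,
    which holds almost everywhere.\<close>
  proof (rule nn_integral_cong_AE)
    show "AE x in M. f x * (\<integral>\<^sup>+y. g y \<partial>N) = (\<integral>\<^sup>+y. f x * g (y - x) \<partial>N)"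
      using M.AE_mem
    proof eventually_elim
      case (elim x)
      show ?case
        using N.nn_integral_translate[of g "- x"] *[OF elim] by (simp add: nn_integral_cmult)
    qed
  qed
  also have "\<dots> = (\<integral>\<^sup>+y. (\<integral>\<^sup>+x. f x * g (y - x) \<partial>M) \<partial>N)"
    by (subst MN.Fubini') simp_all
  also have "\<dots> = (\<integral>\<^sup>+y. (\<integral>\<^sup>+x. f (y - x) * g x \<partial>M) \<partial>N)"
  proof (rule nn_integral_cong_AE)
    show "AE y in N. (\<integral>\<^sup>+x. f x * g (y - x) \<partial>M) = (\<integral>\<^sup>+x. f (y - x) * g x \<partial>M)"
      using N.AE_mem
    proof eventually_elim
      case (elim y)
      show ?case
        using M.nn_integral_translate_reflect[of "\<lambda>x. f x * g (y - x)" y] elim by simp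
    qed
  qed
  also have "\<dots> = (\<integral>\<^sup>+x. (\<integral>\<^sup>+y. f (y - x) * g x \<partial>N) \<partial>M)"
    by (subst MN.Fubini') simp_all
  also have "\<dots> = (\<integral>\<^sup>+x. (\<integral>\<^sup>+y. f y \<partial>N) * g x \<partial>M)"
  proof (rule nn_integral_cong_AE)
    show "AE x in M. (\<integral>\<^sup>+y. f (y - x) * g x \<partial>N) = (\<integral>\<^sup>+y. f y \<partial>N) * g x"
      using M.AE_mem
    proof eventually_elim
      case (elim x)
      show ?case
        using N.nn_integral_translate[of f "- x"] *[OF elim] by (simp add: nn_integral_multc)
    qed
  qed
  also have "\<dots> = (\<integral>\<^sup>+y. f y \<partial>N) * (\<integral>\<^sup>+x. g x \<partial>M)"
    by (simp add: nn_integral_cmult)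
  finally show ?thesis .
qed

section \<open>Gaussian integrals and the characterization of Lebesgue measure on a subspace\<close>

text \<open>Substituting \<open>x = t * y\<close> reduces to the total mass of the standard normal
  density. Width 1 fixes the normalization of the measures below; general \<open>t\<close> yields
  the scaling law.\<close>

lemma nn_integral_gauss:
  fixes t :: real
  assumes "0 < t"
  shows "(\<integral>\<^sup>+x. ennreal (exp (- (x / t)\<^sup>2 / 2)) \<partial>lborel) = ennreal t * ennreal (sqrt (2 * pi))"
proof -
  interpret prob_space "density lborel (normal_density 0 1)"
    by (rule prob_space_normal_density) simp
  have "1 = (\<integral>\<^sup>+x. ennreal (std_normal_density x) \<partial>lborel)"
    using emeasure_space_1 by (simp add: emeasure_density)
  then have "ennreal (sqrt (2 * pi)) = ennreal (sqrt (2 * pi)) * (\<integral>\<^sup>+x. ennreal (std_normal_density x) \<partial>lborel)"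
    by simp
  also have "\<dots> = (\<integral>\<^sup>+x. ennreal (sqrt (2 * pi)) * ennreal (std_normal_density x) \<partial>lborel)"
    by (rule nn_integral_cmult[symmetric]) simp
  also have "\<dots> = (\<integral>\<^sup>+x. ennreal (exp (- x\<^sup>2 / 2)) \<partial>lborel)"
    by (intro nn_integral_cong) (simp add: std_normal_density_def flip: ennreal_mult)
  finally have *: "(\<integral>\<^sup>+x. ennreal (exp (- x\<^sup>2 / 2)) \<partial>lborel) = ennreal (sqrt (2 * pi))" ..
  show ?thesis
    using assms
    by (subst nn_integral_real_affine[where c = t and t = 0]) (simp_all add: *[simplified])
qed

text \<open>Boxes determine the product measure, and the preimage of a box is the box of the
  preimages. The maps \<open>h i\<close> will be shifts and sign changes.\<close>

lemma distr_PiM_lborel_componentwise: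
  fixes h :: "'i \<Rightarrow> real \<Rightarrow> real"
  assumes "finite I"
    and h [measurable]: "\<And>i. i \<in> I \<Longrightarrow> h i \<in> borel_measurable borel"
    and inv: "\<And>i. i \<in> I \<Longrightarrow> distr lborel borel (h i) = lborel"
  shows "distr (\<Pi>\<^sub>M i\<in>I. lborel) (\<Pi>\<^sub>M i\<in>I. lborel) (\<lambda>f. \<lambda>i\<in>I. h i (f i)) = (\<Pi>\<^sub>M i\<in>I. lborel)"
proof -
  interpret finite_product_sigma_finite "\<lambda>_. lborel :: real measure" I
    by standard fact
  show ?thesis
  proof (rule PiM_eqI[OF \<open>finite I\<close>])
  have meas: "(\<lambda>f. \<lambda>i\<in>I. h i (f i)) \<in> (\<Pi>\<^sub>M i\<in>I. lborel) \<rightarrow>\<^sub>M (\<Pi>\<^sub>M i\<in>I. lborel)"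
    by measurable
  fix A :: "'i \<Rightarrow> real set" assume A [measurable]: "\<And>i. i \<in> I \<Longrightarrow> A i \<in> sets lborel"
  have "emeasure (distr (\<Pi>\<^sub>M i\<in>I. lborel) (\<Pi>\<^sub>M i\<in>I. lborel) (\<lambda>f. \<lambda>i\<in>I. h i (f i))) (Pi\<^sub>E I A)
      = emeasure (\<Pi>\<^sub>M i\<in>I. lborel) ((\<lambda>f. \<lambda>i\<in>I. h i (f i)) -` Pi\<^sub>E I A \<inter> space (\<Pi>\<^sub>M i\<in>I. lborel))"
    by (rule emeasure_distr[OF meas]) (use A \<open>finite I\<close> in \<open>auto intro!: sets_PiM_I_finite\<close>)
  also have "(\<lambda>f. \<lambda>i\<in>I. h i (f i)) -` Pi\<^sub>E I A \<inter> space (\<Pi>\<^sub>M i\<in>I. lborel) = (\<Pi>\<^sub>E i\<in>I. h i -` A i)"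
    by (auto simp: space_PiM PiE_def Pi_def)
  also have "emeasure (\<Pi>\<^sub>M i\<in>I. lborel) (\<Pi>\<^sub>E i\<in>I. h i -` A i) = (\<Prod>i\<in>I. emeasure lborel (h i -` A i))"
    using measurable_sets[OF h] A by (intro measure_times) auto
  also have "\<dots> = (\<Prod>i\<in>I. emeasure lborel (A i))"
  proof (rule prod.cong)
    fix i assume "i \<in> I"
    then have "emeasure (distr lborel borel (h i)) (A i) = emeasure lborel (h i -` A i)"
      by (subst emeasure_distr) (use A in auto)
    then show "emeasure lborel (h i -` A i) = emeasure lborel (A i)"
      using inv[OF \<open>i \<in> I\<close>] by simp
  qed simp
  finally show "emeasure (distr (\<Pi>\<^sub>M i\<in>I. lborel) (\<Pi>\<^sub>M i\<in>I. lborel) (\<lambda>f. \<lambda>i\<in>I. h i (f i))) (Pi\<^sub>E I A)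
      = (\<Prod>i\<in>I. emeasure lborel (A i))" .
  qed simp
qed

lemma orthonormal_basis_dim:
  assumes "orthonormal_basis S B"
  shows "finite B" "card B = dim S" "independent B"
proof -
  have "0 \<notin> B" using assms by (force simp: orthonormal_basis_def)
  then show ind: "independent B"
    using assms pairwise_orthogonal_independent by (auto simp: orthonormal_basis_def)
  show "finite B" using ind independent_imp_finite by blast
  show "card B = dim S"
    using assms ind by (metis dim_eq_card orthonormal_basis_def span_span)
qed

lemma orthonormal_basis_norm_sum:
  assumes "orthonormal_basis S B"
  shows "(norm (\<Sum>b\<in>B. f b *\<^sub>R b))\<^sup>2 = (\<Sum>b\<in>B. (f b)\<^sup>2)"
proof -
  have "(norm (\<Sum>b\<in>B. f b *\<^sub>R b))\<^sup>2 = (\<Sum>b\<in>B. (norm (f b *\<^sub>R b))\<^sup>2)"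
    using assms orthonormal_basis_dim(1)[OF assms]
    by (intro norm_sum_Pythagorean)
       (auto simp: orthonormal_basis_def pairwise_def orthogonal_def)
  also have "\<dots> = (\<Sum>b\<in>B. (f b)\<^sup>2)"
    using assms by (intro sum.cong) (auto simp: orthonormal_basis_def)
  finally show ?thesis .
qed

text \<open>The basis picked by \<open>SOME\<close> enters later arguments only through the
  properties obtained here.\<close>

lemma subspace_lborelE:
  assumes "subspace S"
  obtains B where "orthonormal_basis S B"
    and "subspace_lborel S = distr (\<Pi>\<^sub>M b\<in>B. lborel) borel (\<lambda>f. \<Sum>b\<in>B. f b *\<^sub>R b)"
  using that someI_ex[OF orthonormal_basis_exists[OF assms]]
  by (auto simp: subspace_lborel_def Let_def)

text \<open>By Pythagoras the Gaussian of the norm factors over orthonormal coordinates. The value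
  depends on the dimension alone and not on the basis, which makes it a suitable
  normalization.\<close>

lemma nn_integral_subspace_lborel_gauss:
  assumes "subspace S" "0 < t"
  shows "(\<integral>\<^sup>+x. ennreal (exp (- (norm x / t)\<^sup>2 / 2)) \<partial>subspace_lborel S)
       = (ennreal t * ennreal (sqrt (2 * pi))) ^ dim S"
proof -
  obtain B where B: "orthonormal_basis S B"
    and M: "subspace_lborel S = distr (\<Pi>\<^sub>M b\<in>B. lborel) borel (\<lambda>f. \<Sum>b\<in>B. f b *\<^sub>R b)"
    using subspace_lborelE[OF assms(1)] .
  note dim = orthonormal_basis_dim[OF B]
  interpret finite_product_sigma_finite "\<lambda>_. lborel :: real measure" B
    by standard fact
  have "(\<integral>\<^sup>+x. ennreal (exp (- (norm x / t)\<^sup>2 / 2)) \<partial>subspace_lborel S)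
      = (\<integral>\<^sup>+f. ennreal (exp (- (norm (\<Sum>b\<in>B. f b *\<^sub>R b) / t)\<^sup>2 / 2)) \<partial>(\<Pi>\<^sub>M b\<in>B. lborel))"
    unfolding M by (rule nn_integral_distr) measurable
  also have "\<dots> = (\<integral>\<^sup>+f. (\<Prod>b\<in>B. ennreal (exp (- (f b / t)\<^sup>2 / 2))) \<partial>(\<Pi>\<^sub>M b\<in>B. lborel))"
  proof (rule nn_integral_cong)
    fix f :: "'a \<Rightarrow> real"
    have "- (norm (\<Sum>b\<in>B. f b *\<^sub>R b) / t)\<^sup>2 / 2 = (\<Sum>b\<in>B. - (f b / t)\<^sup>2 / 2)"
      by (simp add: power_divide orthonormal_basis_norm_sum[OF B] sum_divide_distrib sum_negf)
    then show "ennreal (exp (- (norm (\<Sum>b\<in>B. f b *\<^sub>R b) / t)\<^sup>2 / 2))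
        = (\<Prod>b\<in>B. ennreal (exp (- (f b / t)\<^sup>2 / 2)))"
      by (simp only: exp_sum[OF dim(1)]) (simp add: prod_ennreal)
  qed
  also have "\<dots> = (\<Prod>b\<in>B. \<integral>\<^sup>+x. ennreal (exp (- (x / t)\<^sup>2 / 2)) \<partial>lborel)"
    by (rule product_nn_integral_prod) (use dim in auto)
  also have "\<dots> = (ennreal t * ennreal (sqrt (2 * pi))) ^ dim S"
    using nn_integral_gauss[OF assms(2)] dim(2) by (simp only: prod_constant)
  finally show ?thesis .
qed

text \<open>On a set within radius \<open>R\<close> of the origin the Gaussian is at least
  \<open>exp (- R\<^sup>2 / 2)\<close>, so its integral controls the measure of the set. Applied to
  balls, this gives sigma-finiteness.\<close>

lemma emeasure_bounded_finite_of_gauss: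
  fixes M :: "'a::euclidean_space measure"
  assumes M [simp, measurable_cong]: "sets M = sets borel"
    and fin: "(\<integral>\<^sup>+x. ennreal (exp (- (norm x)\<^sup>2 / 2)) \<partial>M) < \<infinity>"
    and "bounded A" and A [measurable]: "A \<in> sets borel"
  shows "emeasure M A < \<infinity>"
proof -
  obtain R where R: "\<And>x. x \<in> A \<Longrightarrow> norm x \<le> R"
    using \<open>bounded A\<close> by (auto simp: bounded_iff)
  have "emeasure M A = (\<integral>\<^sup>+x. indicator A x \<partial>M)" by simp
  also have "\<dots> \<le> (\<integral>\<^sup>+x. ennreal (exp (R\<^sup>2 / 2)) * ennreal (exp (- (norm x)\<^sup>2 / 2)) \<partial>M)"
  proof (rule nn_integral_mono)
    fix x
    show "indicator A x \<le> ennreal (exp (R\<^sup>2 / 2)) * ennreal (exp (- (norm x)\<^sup>2 / 2))"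
    proof (cases "x \<in> A")
      case True
      then have "(norm x)\<^sup>2 \<le> R\<^sup>2" using R by (simp add: power_mono)
      then have "1 \<le> exp (R\<^sup>2 / 2) * exp (- (norm x)\<^sup>2 / 2)"
        by (simp flip: exp_add)
      then have "1 \<le> ennreal (exp (R\<^sup>2 / 2) * exp (- (norm x)\<^sup>2 / 2))"
        by (simp only: ennreal_ge_1)
      then show ?thesis using True
        by (simp only: ennreal_mult exp_ge_zero indicator_simps)
    qed simp
  qed
  also have "\<dots> = ennreal (exp (R\<^sup>2 / 2)) * (\<integral>\<^sup>+x. ennreal (exp (- (norm x)\<^sup>2 / 2)) \<partial>M)"
    by (rule nn_integral_cmult) measurable
  also have "\<dots> < \<infinity>"
    using fin by (simp add: ennreal_mult_less_top)
  finally show ?thesis .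
qed

lemma sigma_finite_of_gauss:
  fixes M :: "'a::euclidean_space measure"
  assumes M [simp, measurable_cong]: "sets M = sets borel"
    and fin: "(\<integral>\<^sup>+x. ennreal (exp (- (norm x)\<^sup>2 / 2)) \<partial>M) < \<infinity>"
  shows "sigma_finite_measure M"
proof
  let ?A = "range (\<lambda>n. cball 0 (real n)) :: 'a set set"
  have "\<Union> ?A = UNIV"
    by (auto simp: real_arch_simple)
  moreover have "emeasure M a \<noteq> \<infinity>" if "a \<in> ?A" for a
    using that emeasure_bounded_finite_of_gauss[OF M fin, of a] by auto
  ultimately show "\<exists>A. countable A \<and> A \<subseteq> sets M \<and> \<Union> A = space M \<and> (\<forall>a\<in>A. emeasure M a \<noteq> \<infinity>)"
    using sets_eq_imp_space_eq[OF M] by (intro exI[of _ ?A]) auto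
qed

lemma sets_subspace_lborel [simp, measurable_cong]: "sets (subspace_lborel S) = sets borel"
  by (simp add: subspace_lborel_def Let_def)

lemma nn_integral_subspace_lborel_gauss_finite:
  assumes "subspace S"
  shows "(\<integral>\<^sup>+x. ennreal (exp (- (norm x)\<^sup>2 / 2)) \<partial>subspace_lborel S) < \<infinity>"
  using nn_integral_subspace_lborel_gauss[OF assms, of 1]
  by (simp add: less_top[symmetric] power_eq_top_ennreal)

lemma invariant_subspace_lborel:
  assumes S: "subspace S"
  shows "invariant_measure (subspace_lborel S) S"
proof -
  let ?M = "subspace_lborel S"
  obtain B where B: "orthonormal_basis S B"
    and M: "?M = distr (\<Pi>\<^sub>M b\<in>B. lborel) borel (\<lambda>f. \<Sum>b\<in>B. f b *\<^sub>R b)"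
    using subspace_lborelE[OF assms(1)] .
  note dim = orthonormal_basis_dim[OF B]
  let ?P = "\<Pi>\<^sub>M b\<in>B. (lborel :: real measure)" and ?\<phi> = "\<lambda>f. \<Sum>b\<in>B. f b *\<^sub>R b"
  \<comment> \<open>Translation by a vector of \<open>S\<close> and reflection both act
    coordinatewise in the basis \<open>B\<close>, so one argument covers both: pull \<open>T\<close>
    back through the coordinate map and use invariance of the product measure.\<close>
  have inv: "distr ?M borel T = ?M"
    if T [measurable]: "T \<in> borel_measurable borel"
      and h [measurable]: "\<And>b. b \<in> B \<Longrightarrow> h b \<in> borel_measurable borel"
      and hd: "\<And>b. b \<in> B \<Longrightarrow> distr lborel borel (h b) = lborel"
      and Th: "\<And>f. T (?\<phi> f) = (\<Sum>b\<in>B. h b (f b) *\<^sub>R b)"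
    for T and h :: "'a \<Rightarrow> real \<Rightarrow> real"
  proof -
    have "distr ?M borel T = distr ?P borel (T \<circ> ?\<phi>)"
      unfolding M by (rule distr_distr) measurable
    also have "T \<circ> ?\<phi> = ?\<phi> \<circ> (\<lambda>f. \<lambda>b\<in>B. h b (f b))"
      by (auto simp: Th)
    also have "distr ?P borel \<dots> = distr (distr ?P ?P (\<lambda>f. \<lambda>b\<in>B. h b (f b))) borel ?\<phi>"
      by (rule distr_distr[symmetric]) measurable
    also have "\<dots> = ?M"
      using distr_PiM_lborel_componentwise[OF dim(1) h hd] by (simp add: M)
    finally show ?thesis .
  qed
  have "AE x in ?M. x \<in> S"
  proof -
    have "?\<phi> f \<in> S" for f
      using B by (auto simp: orthonormal_basis_def intro!: subspace_sum[OF S] subspace_scale[OF S])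
    moreover have "{x. x \<in> S} \<in> sets borel" using closed_subspace[OF S] by simp
    ultimately show ?thesis
      unfolding M by (subst AE_distr_iff) auto
  qed
  moreover have "distr ?M borel ((+) v) = ?M" if "v \<in> S" for v
  proof -
    from that B obtain c where c: "v = (\<Sum>b\<in>B. c b *\<^sub>R b)"
      by (auto simp: orthonormal_basis_def span_finite[OF dim(1)])
    show ?thesis
      by (rule inv[where h = "\<lambda>b. (+) (c b)"])
         (auto simp: lborel_distr_plus c scaleR_add_left sum.distrib)
  qed
  moreover have "distr ?M borel uminus = ?M"
    by (rule inv[where h = "\<lambda>b. uminus"])
       (auto simp: lborel_distr_uminus sum_negf)
  moreover have "sigma_finite_measure ?M"
    by (rule sigma_finite_of_gauss[OF _ nn_integral_subspace_lborel_gauss_finite[OF S]]) simp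
  ultimately show ?thesis
    by (simp add: invariant_measure_def invariant_measure_axioms_def S)
qed

text \<open>Uniqueness tested against the Gaussian shows that the two measures are proportional. The
  Gaussian integral is positive and finite, so it can be cancelled and the factor is
  \<open>a\<close>. Below, \<open>a\<close> is a power of \<open>t\<close> for dilations and 1 for
  the orthogonal decomposition.\<close>

lemma eq_subspace_lborel:
  assumes M: "invariant_measure M S"
    and gauss: "(\<integral>\<^sup>+x. ennreal (exp (- (norm x)\<^sup>2 / 2)) \<partial>M) = a * ennreal (sqrt (2 * pi)) ^ dim S"
    and f [measurable]: "f \<in> borel_measurable borel"
  shows "(\<integral>\<^sup>+x. f x \<partial>M) = a * (\<integral>\<^sup>+x. f x \<partial>subspace_lborel S)"
proof -
  interpret M: invariant_measure M S by fact
  let ?c = "ennreal (sqrt (2 * pi)) ^ dim S"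
  have c: "?c \<noteq> 0" "?c \<noteq> top"
    by (auto simp: power_eq_top_ennreal)
  have "(\<integral>\<^sup>+x. f x \<partial>M) * ?c = (\<integral>\<^sup>+x. f x \<partial>subspace_lborel S) * (a * ?c)"
    using invariant_measure_unique[OF M invariant_subspace_lborel[OF M.subspace_S] f,
        of "\<lambda>x. ennreal (exp (- (norm x)\<^sup>2 / 2))"]
      nn_integral_subspace_lborel_gauss[OF M.subspace_S, of 1] gauss
    by simp
  also have "\<dots> = (a * (\<integral>\<^sup>+x. f x \<partial>subspace_lborel S)) * ?c"
    by (simp add: mult_ac)
  finally have "(\<integral>\<^sup>+x. f x \<partial>M) * ?c / ?c = (a * (\<integral>\<^sup>+x. f x \<partial>subspace_lborel S)) * ?c / ?c"
    by (rule arg_cong)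
  then show ?thesis
    unfolding mult_divide_eq_ennreal[OF c] .
qed

section \<open>Dilations and finiteness on bounded sets\<close>

text \<open>The image of the measure under division by \<open>t\<close> is again invariant. Its
  standard Gaussian integral is the Gaussian integral of width \<open>t\<close> for the original
  measure, which supplies the factor \<open>ennreal t ^ dim S\<close>.\<close>

lemma nn_integral_subspace_lborel_scale:
  assumes S: "subspace S" and "0 < t" and f [measurable]: "f \<in> borel_measurable borel"
  shows "(\<integral>\<^sup>+x. f (x /\<^sub>R t) \<partial>subspace_lborel S) = ennreal t ^ dim S * (\<integral>\<^sup>+x. f x \<partial>subspace_lborel S)"
proof -
  interpret invariant_measure "subspace_lborel S" S by (rule invariant_subspace_lborel[OF S])
  let ?N = "distr (subspace_lborel S) borel (\<lambda>x. x /\<^sub>R t)"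
  have nn: "(\<integral>\<^sup>+x. g x \<partial>?N) = (\<integral>\<^sup>+x. g (x /\<^sub>R t) \<partial>subspace_lborel S)"
    if [measurable]: "g \<in> borel_measurable borel" for g
    by (rule nn_integral_distr) measurable
  have gauss: "(\<integral>\<^sup>+x. ennreal (exp (- (norm x)\<^sup>2 / 2)) \<partial>?N)
      = ennreal t ^ dim S * ennreal (sqrt (2 * pi)) ^ dim S"
  proof -
    have "norm (x /\<^sub>R t) = norm x / t" for x :: 'a
      using \<open>0 < t\<close> by (simp add: divide_inverse mult.commute)
    then show ?thesis
      using nn_integral_subspace_lborel_gauss[OF S \<open>0 < t\<close>]
      by (subst nn) (simp_all only: power_mult_distrib, measurable)
  qed
  have "invariant_measure ?N S"
  proof -
    have "sigma_finite_measure ?N"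
      by (rule sigma_finite_of_gauss) (simp, simp only: gauss, simp add: less_top[symmetric] ennreal_mult_eq_top_iff power_eq_top_ennreal)
    moreover have "AE x in ?N. x \<in> S"
    proof -
      have "{x. x \<in> S} \<in> sets borel" using closed_subspace[OF S] by simp
      moreover have "AE x in subspace_lborel S. x /\<^sub>R t \<in> S"
        using AE_mem by eventually_elim (rule subspace_scale[OF S])
      ultimately show ?thesis by (subst AE_distr_iff) auto
    qed
    moreover have "distr ?N borel ((+) v) = ?N" if "v \<in> S" for v
    proof -
      have tv: "t *\<^sub>R v \<in> S" using that by (rule subspace_scale[OF S])
      have "distr ?N borel ((+) v) = distr (subspace_lborel S) borel ((+) v \<circ> (\<lambda>x. x /\<^sub>R t))"
        by (rule distr_distr) measurable
      also have "(+) v \<circ> (\<lambda>x. x /\<^sub>R t) = (\<lambda>x. x /\<^sub>R t) \<circ> (+) (t *\<^sub>R v)"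
        using \<open>0 < t\<close> by (auto simp: scaleR_add_right)
      also have "distr (subspace_lborel S) borel \<dots> = distr (distr (subspace_lborel S) borel ((+) (t *\<^sub>R v))) borel (\<lambda>x. x /\<^sub>R t)"
        by (rule distr_distr[symmetric]) measurable
      also have "\<dots> = ?N" by (simp add: translation[OF tv])
      finally show ?thesis .
    qed
    moreover have "distr ?N borel uminus = ?N"
    proof -
      have "distr ?N borel uminus = distr (subspace_lborel S) borel (uminus \<circ> (\<lambda>x. x /\<^sub>R t))"
        by (rule distr_distr) measurable
      also have "uminus \<circ> (\<lambda>x::'a. x /\<^sub>R t) = (\<lambda>x. x /\<^sub>R t) \<circ> uminus"
        by (simp add: fun_eq_iff)
      also have "distr (subspace_lborel S) borel \<dots> = distr (distr (subspace_lborel S) borel uminus) borel (\<lambda>x. x /\<^sub>R t)"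
        by (rule distr_distr[symmetric]) measurable
      also have "\<dots> = ?N" by (simp add: reflection)
      finally show ?thesis .
    qed
    ultimately show ?thesis
      by (simp add: invariant_measure_def invariant_measure_axioms_def S)
  qed
  from eq_subspace_lborel[OF this gauss f] show ?thesis
    by (simp add: nn)
qed

lemma emeasure_subspace_lborel_scale:
  assumes S: "subspace S" and "0 < t" and [measurable]: "A \<in> sets borel"
  shows "emeasure (subspace_lborel S) ((*\<^sub>R) t ` A) = ennreal t ^ dim S * emeasure (subspace_lborel S) A"
proof -
  have eq: "(*\<^sub>R) t ` A = (\<lambda>x. x /\<^sub>R t) -` A"
  proof (intro equalityI subsetI)
    fix x assume "x \<in> (\<lambda>x. x /\<^sub>R t) -` A"
    then show "x \<in> (*\<^sub>R) t ` A"
      using \<open>0 < t\<close> by (intro image_eqI[of _ _ "x /\<^sub>R t"]) auto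
  qed (use \<open>0 < t\<close> in auto)
  have [measurable]: "(*\<^sub>R) t ` A \<in> sets borel"
    unfolding eq using measurable_sets[of "\<lambda>x. x /\<^sub>R t" borel borel A] by simp
  have "emeasure (subspace_lborel S) ((*\<^sub>R) t ` A) = (\<integral>\<^sup>+x. indicator ((*\<^sub>R) t ` A) x \<partial>subspace_lborel S)"
    by simp
  also have "\<dots> = (\<integral>\<^sup>+x. indicator A (x /\<^sub>R t) \<partial>subspace_lborel S)"
    by (intro nn_integral_cong) (simp add: eq indicator_def)
  also have "\<dots> = ennreal t ^ dim S * emeasure (subspace_lborel S) A"
    by (subst nn_integral_subspace_lborel_scale[OF S \<open>0 < t\<close>]) simp_all
  finally show ?thesis .
qed

lemma emeasure_subspace_lborel_finite:
  assumes "subspace S" "bounded A" "A \<in> sets borel"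
  shows "emeasure (subspace_lborel S) A < \<infinity>"
  by (rule emeasure_bounded_finite_of_gauss[OF _ nn_integral_subspace_lborel_gauss_finite[OF assms(1)]])
     (use assms in simp_all)

section \<open>Decomposition along an orthogonal complement, and positivity on balls\<close>

lemma distr_eq_if_nn_integral_eq:
  assumes sets: "sets M = sets borel" and T: "T \<in> borel_measurable M"
    and eq: "\<And>f. f \<in> borel_measurable borel \<Longrightarrow> (\<integral>\<^sup>+x. f (T x) \<partial>M) = (\<integral>\<^sup>+x. f x \<partial>M)"
  shows "distr M borel T = M"
proof (rule measure_eqI)
  fix A assume "A \<in> sets (distr M borel T)"
  then have A: "A \<in> sets borel" by simp
  have "emeasure (distr M borel T) A = (\<integral>\<^sup>+x. indicator A x \<partial>distr M borel T)"
    using A by simp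
  also have "\<dots> = (\<integral>\<^sup>+x. indicator A (T x) \<partial>M)"
    using A T by (intro nn_integral_distr) auto
  also have "\<dots> = emeasure M A"
    using eq[of "indicator A"] A sets by simp
  finally show "emeasure (distr M borel T) A = emeasure M A" .
qed (simp add: sets)

lemma dim_Int_orthogonal_comp:
  fixes E F :: "'a::euclidean_space set"
  assumes "subspace E" "subspace F" "E \<subseteq> F"
  shows "dim (F \<inter> E\<^sup>\<bottom>) + dim E = dim F"
proof -
  have "F \<inter> E\<^sup>\<bottom> = {y \<in> F. \<forall>x \<in> E. orthogonal x y}"
    by (auto simp: orthogonal_comp_def)
  then show ?thesis
    using dim_subspace_orthogonal_to_vectors[OF assms] by simp
qed

lemma subspace_decompE:
  fixes E F :: "'a::euclidean_space set"
  assumes "subspace E" "subspace F" "E \<subseteq> F" "v \<in> F"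
  obtains g e where "v = g + e" "g \<in> F \<inter> E\<^sup>\<bottom>" "e \<in> E"
proof -
  obtain e g where *: "v = e + g" "e \<in> E" "g \<in> E\<^sup>\<bottom>"
    using subspace_sum_orthogonal_comp[OF assms(1)] set_plus_elim by blast
  moreover have "g \<in> F"
    using subspace_diff[OF \<open>subspace F\<close> \<open>v \<in> F\<close>, of e] * \<open>E \<subseteq> F\<close> by auto
  ultimately show ?thesis by (intro that[of g e]) auto
qed

text \<open>The image of the product measure under addition is invariant on \<open>F\<close>. By
  Pythagoras its Gaussian integral is the product of the two Gaussian integrals, and the dimensions
  add up to \<open>dim F\<close>, so the constant of proportionality is 1.\<close>

lemma nn_integral_subspace_lborel_decomp:
  assumes E: "subspace E" and F: "subspace F" and EF: "E \<subseteq> F"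
    and f [measurable]: "f \<in> borel_measurable borel"
  shows "(\<integral>\<^sup>+x. f x \<partial>subspace_lborel F)
       = (\<integral>\<^sup>+x. \<integral>\<^sup>+e. f (x + e) \<partial>subspace_lborel E \<partial>subspace_lborel (F \<inter> E\<^sup>\<bottom>))"
proof -
  let ?G = "F \<inter> E\<^sup>\<bottom>"
  have G: "subspace ?G"
    by (intro subspace_inter F subspace_orthogonal_comp)
  interpret E: invariant_measure "subspace_lborel E" E by (rule invariant_subspace_lborel[OF E])
  interpret G: invariant_measure "subspace_lborel ?G" ?G by (rule invariant_subspace_lborel[OF G])
  interpret GE: pair_sigma_finite "subspace_lborel ?G" "subspace_lborel E" ..
  let ?N = "distr (subspace_lborel ?G \<Otimes>\<^sub>M subspace_lborel E) borel (\<lambda>(x, y). x + y)"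
  have nn: "(\<integral>\<^sup>+x. g x \<partial>?N) = (\<integral>\<^sup>+x. \<integral>\<^sup>+e. g (x + e) \<partial>subspace_lborel E \<partial>subspace_lborel ?G)"
    if [measurable]: "g \<in> borel_measurable borel" for g
  proof -
    have "(\<integral>\<^sup>+x. g x \<partial>?N) = (\<integral>\<^sup>+z. g (case z of (x, y) \<Rightarrow> x + y) \<partial>(subspace_lborel ?G \<Otimes>\<^sub>M subspace_lborel E))"
      by (rule nn_integral_distr) measurable
    also have "\<dots> = (\<integral>\<^sup>+x. \<integral>\<^sup>+e. g (x + e) \<partial>subspace_lborel E \<partial>subspace_lborel ?G)"
      by (subst E.nn_integral_fst[symmetric]) auto
    finally show ?thesis .
  qed
  have gauss: "(\<integral>\<^sup>+x. ennreal (exp (- (norm x)\<^sup>2 / 2)) \<partial>?N) = 1 * ennreal (sqrt (2 * pi)) ^ dim F"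
  proof -
    let ?g = "\<lambda>x::'a. ennreal (exp (- (norm x)\<^sup>2 / 2))"
    have "(\<integral>\<^sup>+x. ?g x \<partial>?N) = (\<integral>\<^sup>+x. \<integral>\<^sup>+e. ?g (x + e) \<partial>subspace_lborel E \<partial>subspace_lborel ?G)"
      by (rule nn) measurable
    also have "\<dots> = (\<integral>\<^sup>+x. \<integral>\<^sup>+e. ?g x * ?g e \<partial>subspace_lborel E \<partial>subspace_lborel ?G)"
    proof (rule nn_integral_cong_AE, use G.AE_mem in eventually_elim, rule nn_integral_cong_AE,
           use E.AE_mem in eventually_elim)
      fix x e assume "x \<in> ?G" "e \<in> E"
      then have "orthogonal x e"
        by (auto simp: orthogonal_comp_def orthogonal_commute)
      then have "(norm (x + e))\<^sup>2 = (norm x)\<^sup>2 + (norm e)\<^sup>2"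
        by (rule norm_add_Pythagorean)
      then show "?g (x + e) = ?g x * ?g e"
        by (simp add: add_divide_distrib flip: ennreal_mult exp_add)
    qed
    also have "\<dots> = (\<integral>\<^sup>+x. ?g x \<partial>subspace_lborel ?G) * (\<integral>\<^sup>+e. ?g e \<partial>subspace_lborel E)"
      by (simp add: nn_integral_cmult nn_integral_multc)
    also have "\<dots> = ennreal (sqrt (2 * pi)) ^ dim F"
      using nn_integral_subspace_lborel_gauss[OF E, of 1] nn_integral_subspace_lborel_gauss[OF G, of 1]
        dim_Int_orthogonal_comp[OF E F EF]
      by (simp flip: power_add)
    finally show ?thesis by simp
  qed
  have "invariant_measure ?N F"
  proof -
    have "sigma_finite_measure ?N"
      by (rule sigma_finite_of_gauss) (simp, simp only: gauss, simp add: less_top[symmetric] power_eq_top_ennreal)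
    moreover have "AE x in ?N. x \<in> F"
    proof -
      have "closed F" using F by (rule closed_subspace)
      then have [measurable]: "F \<in> sets borel" by simp
      have "emeasure ?N (- F) = (\<integral>\<^sup>+x. indicator (- F) x \<partial>?N)"
        using \<open>closed F\<close> by (intro nn_integral_indicator[symmetric]) auto
      also have "\<dots> = (\<integral>\<^sup>+x. \<integral>\<^sup>+e. indicator (- F) (x + e) \<partial>subspace_lborel E \<partial>subspace_lborel ?G)"
        using \<open>closed F\<close> by (intro nn) auto
      also have "\<dots> = (\<integral>\<^sup>+x. \<integral>\<^sup>+e. 0 \<partial>subspace_lborel E \<partial>subspace_lborel ?G)"
      proof (rule nn_integral_cong_AE, use G.AE_mem in eventually_elim, rule nn_integral_cong_AE,
           use E.AE_mem in eventually_elim)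
        fix x e assume "x \<in> ?G" "e \<in> E"
        then have "x + e \<in> F" using EF F by (auto intro: subspace_add)
        then show "(indicator (- F) (x + e) :: ennreal) = 0" by simp
      qed
      also have "\<dots> = 0" by simp
      finally show ?thesis
        by (intro AE_I[of _ _ "- F"]) (use \<open>closed F\<close> in auto)
    qed
    moreover have "distr ?N borel ((+) v) = ?N" if "v \<in> F" for v
    proof (rule distr_eq_if_nn_integral_eq)
      \<comment> \<open>The inner integral absorbs the component \<open>e\<close>, the outer one the
        component \<open>g\<close>.\<close>
      obtain g e where v: "v = g + e" "g \<in> ?G" "e \<in> E"
        using subspace_decompE[OF E F EF \<open>v \<in> F\<close>] .
      fix h :: "'a \<Rightarrow> ennreal" assume [measurable]: "h \<in> borel_measurable borel"
      have "(\<integral>\<^sup>+x. h (v + x) \<partial>?N)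
          = (\<integral>\<^sup>+x. \<integral>\<^sup>+y. h (g + x + (e + y)) \<partial>subspace_lborel E \<partial>subspace_lborel ?G)"
        by (subst nn) (simp_all add: v add_ac)
      also have "\<dots> = (\<integral>\<^sup>+x. \<integral>\<^sup>+y. h (g + x + y) \<partial>subspace_lborel E \<partial>subspace_lborel ?G)"
        using v by (subst E.nn_integral_translate) auto
      also have "\<dots> = (\<integral>\<^sup>+x. \<integral>\<^sup>+y. h (x + y) \<partial>subspace_lborel E \<partial>subspace_lborel ?G)"
        using v by (subst G.nn_integral_translate[where f = "\<lambda>z. \<integral>\<^sup>+y. h (z + y) \<partial>subspace_lborel E"]) auto
      also have "\<dots> = (\<integral>\<^sup>+x. h x \<partial>?N)"
        by (rule nn[symmetric]) measurable
      finally show "(\<integral>\<^sup>+x. h (v + x) \<partial>?N) = (\<integral>\<^sup>+x. h x \<partial>?N)" .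
    qed simp_all
    moreover have "distr ?N borel uminus = ?N"
    proof (rule distr_eq_if_nn_integral_eq)
      fix h :: "'a \<Rightarrow> ennreal" assume [measurable]: "h \<in> borel_measurable borel"
      have "(\<integral>\<^sup>+x. h (- x) \<partial>?N)
          = (\<integral>\<^sup>+x. \<integral>\<^sup>+y. h (- x + - y) \<partial>subspace_lborel E \<partial>subspace_lborel ?G)"
        by (subst nn) simp_all
      also have "\<dots> = (\<integral>\<^sup>+x. \<integral>\<^sup>+y. h (- x + y) \<partial>subspace_lborel E \<partial>subspace_lborel ?G)"
        by (subst E.nn_integral_reflect) auto
      also have "\<dots> = (\<integral>\<^sup>+x. \<integral>\<^sup>+y. h (x + y) \<partial>subspace_lborel E \<partial>subspace_lborel ?G)"
        by (subst G.nn_integral_reflect[where f = "\<lambda>z. \<integral>\<^sup>+y. h (z + y) \<partial>subspace_lborel E"]) auto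
      also have "\<dots> = (\<integral>\<^sup>+x. h x \<partial>?N)"
        by (rule nn[symmetric]) measurable
      finally show "(\<integral>\<^sup>+x. h (- x) \<partial>?N) = (\<integral>\<^sup>+x. h x \<partial>?N)" .
    qed simp_all
    ultimately show ?thesis
      by (simp add: invariant_measure_def invariant_measure_axioms_def F)
  qed
  from eq_subspace_lborel[OF this gauss f] show ?thesis
    by (simp add: nn)
qed

text \<open>If the unit ball were null, then by scaling every centred ball and hence the whole space
  would be null, contradicting the positive Gaussian integral. Translation by \<open>v\<close> moves
  the centre.\<close>

lemma emeasure_subspace_lborel_ball_pos:
  assumes S: "subspace S" and "v \<in> S" and "0 < r"
  shows "0 < emeasure (subspace_lborel S) (ball v r)"
proof -
  interpret invariant_measure "subspace_lborel S" S by (rule invariant_subspace_lborel[OF S])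
  have scale: "emeasure (subspace_lborel S) (ball 0 t) = ennreal t ^ dim S * emeasure (subspace_lborel S) (ball 0 1)"
    if "0 < t" for t
  proof -
    have "(*\<^sub>R) t ` ball 0 1 = (ball 0 t :: 'a set)"
      using that ball_scale[of t "0::'a" 1] by simp
    then show ?thesis
      using emeasure_subspace_lborel_scale[OF S that, of "ball 0 1"] by simp
  qed
  have pos: "emeasure (subspace_lborel S) (ball 0 1) \<noteq> 0"
  proof
    assume zero: "emeasure (subspace_lborel S) (ball 0 1) = 0"
    have "emeasure (subspace_lborel S) (\<Union>n. ball 0 (real (Suc n))) = 0"
      by (rule emeasure_UN_eq_0) (use scale zero in auto)
    moreover have "(\<Union>n. ball 0 (real (Suc n))) = (UNIV :: 'a set)"
    proof -
      have "\<exists>n. norm x < real (Suc n)" for x :: 'a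
        using reals_Archimedean2[of "norm x"] by (metis less_add_one less_trans of_nat_Suc add.commute)
      then show ?thesis by auto
    qed
    ultimately have "emeasure (subspace_lborel S) UNIV = 0" by simp
    then have "AE x in subspace_lborel S. ennreal (exp (- (norm x / 1)\<^sup>2 / 2)) = 0"
      by (intro AE_I[of _ _ UNIV]) auto
    then have "(\<integral>\<^sup>+x. ennreal (exp (- (norm x / 1)\<^sup>2 / 2)) \<partial>subspace_lborel S) = 0"
      by (subst nn_integral_0_iff_AE) auto
    then show False
      using nn_integral_subspace_lborel_gauss[OF S, of 1] by (simp add: power_0_left split: if_splits)
  qed
  have "emeasure (subspace_lborel S) (ball v r) = emeasure (subspace_lborel S) (ball 0 r)"
    using emeasure_translate[of "ball 0 r" v] \<open>v \<in> S\<close> by simp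
  also have "\<dots> > 0"
    using pos \<open>0 < r\<close> by (subst scale) (simp_all add: zero_less_iff_neq_zero ennreal_eq_0_iff)
  finally show ?thesis .
qed

section \<open>Orthogonal projections\<close>

text \<open>Two candidates differ by a vector in both \<open>F\<close> and its orthogonal
  complement, hence by 0. This gives access to the definite description in
  \<open>orth_proj\<close>.\<close>

lemma orth_proj_eqI:
  fixes F :: "'a::euclidean_space set"
  assumes "subspace F" "y \<in> F" "x - y \<in> F\<^sup>\<bottom>"
  shows "orth_proj F x = y"
  unfolding orth_proj_def
proof (rule the_equality)
  fix z assume z: "z \<in> F \<and> x - z \<in> F\<^sup>\<bottom>"
  have "z - y \<in> F" using z assms subspace_diff by blast
  moreover have "(x - y) - (x - z) \<in> F\<^sup>\<bottom>"
    using z assms subspace_diff[OF subspace_orthogonal_comp] by blast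
  ultimately have "z - y \<in> F \<inter> F\<^sup>\<bottom>" by simp
  then show "z = y" using orthogonal_Int_0[OF assms(1)] by auto
qed (use assms in simp)

lemma orth_proj_mem:
  fixes F :: "'a::euclidean_space set"
  assumes "subspace F"
  shows "orth_proj F x \<in> F" "x - orth_proj F x \<in> F\<^sup>\<bottom>"
proof -
  obtain y z where "x = y + z" "y \<in> F" "z \<in> F\<^sup>\<bottom>"
    using subspace_sum_orthogonal_comp[OF assms] set_plus_elim by blast
  then have "y \<in> F" "x - y \<in> F\<^sup>\<bottom>" by auto
  then show "orth_proj F x \<in> F" "x - orth_proj F x \<in> F\<^sup>\<bottom>"
    using orth_proj_eqI[OF assms, of y x] by auto
qed

lemma orth_proj_id:
  fixes F :: "'a::euclidean_space set"
  assumes "subspace F" "x \<in> F"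
  shows "orth_proj F x = x"
  using assms subspace_0[OF subspace_orthogonal_comp] by (intro orth_proj_eqI) auto

lemma linear_orth_proj:
  fixes F :: "'a::euclidean_space set"
  assumes F: "subspace F"
  shows "linear (orth_proj F)"
proof
  fix x y :: 'a and c :: real
  have "x + y - (orth_proj F x + orth_proj F y) \<in> F\<^sup>\<bottom>"
    using subspace_add[OF subspace_orthogonal_comp orth_proj_mem(2)[OF F, of x] orth_proj_mem(2)[OF F, of y]]
    by (simp add: algebra_simps)
  then show "orth_proj F (x + y) = orth_proj F x + orth_proj F y"
    by (intro orth_proj_eqI[OF F] subspace_add[OF F] orth_proj_mem(1)[OF F])
  have "c *\<^sub>R x - c *\<^sub>R orth_proj F x \<in> F\<^sup>\<bottom>"
    using subspace_scale[OF subspace_orthogonal_comp orth_proj_mem(2)[OF F, of x]]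
    by (simp add: algebra_simps)
  then show "orth_proj F (c *\<^sub>R x) = c *\<^sub>R orth_proj F x"
    by (intro orth_proj_eqI[OF F] subspace_scale[OF F] orth_proj_mem(1)[OF F])
qed

lemma compact_orth_proj:
  fixes F :: "'a::euclidean_space set"
  assumes "subspace F" "compact K"
  shows "compact (orth_proj F ` K)"
  using assms linear_orth_proj compact_continuous_image linear_continuous_on linear_conv_bounded_linear
  by metis

text \<open>If \<open>K\<close> contains the ball of radius \<open>r\<close> about \<open>a\<close>,
  its projection contains the ball of the same radius in \<open>F\<close> about the projection of
  \<open>a\<close>: a point \<open>w\<close> there lifts to
  \<open>a + (w - orth_proj F a)\<close>.\<close>

lemma emeasure_orth_proj_pos:
  fixes F :: "'a::euclidean_space set"
  assumes F: "subspace F" and "compact K" "interior K \<noteq> {}"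
  shows "0 < emeasure (subspace_lborel F) (orth_proj F ` K)"
proof -
  interpret invariant_measure "subspace_lborel F" F by (rule invariant_subspace_lborel[OF F])
  interpret linear "orth_proj F" by (rule linear_orth_proj[OF F])
  have cl: "closed (orth_proj F ` K)" "closed F"
    using compact_orth_proj[OF F \<open>compact K\<close>] closed_subspace[OF F] by (auto intro: compact_imp_closed)
  obtain a r where "0 < r" and r: "ball a r \<subseteq> K"
    using \<open>interior K \<noteq> {}\<close> by (auto simp: mem_interior)
  have "ball (orth_proj F a) r \<inter> F \<subseteq> orth_proj F ` K"
  proof
    fix w assume w: "w \<in> ball (orth_proj F a) r \<inter> F"
    have "w - orth_proj F a \<in> F"
      using w orth_proj_mem(1)[OF F] subspace_diff[OF F] by blast
    then have "orth_proj F (a + (w - orth_proj F a)) = w"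
      by (simp only: add orth_proj_id[OF F]) simp
    moreover have "a + (w - orth_proj F a) \<in> K"
      using w r by (auto simp: dist_norm norm_minus_commute)
    ultimately show "w \<in> orth_proj F ` K" by (metis imageI)
  qed
  then have "emeasure (subspace_lborel F) (ball (orth_proj F a) r \<inter> F)
      \<le> emeasure (subspace_lborel F) (orth_proj F ` K)"
    using cl by (intro emeasure_mono) auto
  moreover have "0 < emeasure (subspace_lborel F) (ball (orth_proj F a) r \<inter> F)"
    using emeasure_subspace_lborel_ball_pos[OF F orth_proj_mem(1)[OF F] \<open>0 < r\<close>]
    by (subst emeasure_Int_S) auto
  ultimately show ?thesis by simp
qed

section \<open>Covariograms and slices\<close>

text \<open>The value is \<open>l * Beta (k + 1) l\<close>, that is l! k! / (l + k)!. This is the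
  source of the binomial coefficient in the theorem.\<close>

lemma nn_integral_beta_weight:
  assumes "1 \<le> l"
  shows "(\<integral>\<^sup>+t. ennreal (real l * (1 - t) ^ (l - 1) * t ^ k) * indicator {0<..<1} t \<partial>lborel)
       = ennreal (1 / real ((l + k) choose k))"
proof (rule nn_integral_has_integral_lebesgue')
  \<comment> \<open>On the open interval both \<open>t\<close> and \<open>1 - t\<close> are
    positive, as the passage from \<open>powr\<close> to natural powers requires.\<close>
  have "((\<lambda>t. t powr (real (k + 1) - 1) * (1 - t) powr (real l - 1)) has_integral Beta (real (k + 1)) (real l)) {0<..<1}"
    using has_integral_Beta_real[of "real (k + 1)" "real l"] assms
    by (simp add: has_integral_Icc_iff_Ioo)
  then have "((\<lambda>t. t ^ k * (1 - t) ^ (l - 1)) has_integral Beta (real (k + 1)) (real l)) {0<..<1}"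
    by (rule has_integral_eq[rotated])
       (use assms in \<open>simp flip: powr_realpow add: of_nat_diff\<close>)
  then have "((\<lambda>t. real l * (t ^ k * (1 - t) ^ (l - 1))) has_integral real l * Beta (real (k + 1)) (real l)) {0<..<1}"
    by (rule has_integral_mult_right)
  moreover have "real l * Beta (real (k + 1)) (real l) = 1 / real ((l + k) choose k)"
  proof -
    obtain m where m: "l = Suc m" using assms by (cases l) auto
    have G1: "Gamma (real (k + 1)) = fact k"
      using Gamma_fact[of k, where 'a = real] by (simp add: add.commute)
    have G2: "Gamma (real l) = fact m"
      using Gamma_fact[of m, where 'a = real] by (simp add: m add.commute)
    have G3: "Gamma (real (k + 1) + real l) = fact (l + k)"
      using Gamma_fact[of "l + k", where 'a = real] by (simp add: algebra_simps)
    show ?thesis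
      unfolding Beta_def G1 G2 G3
      by (subst binomial_fact) (simp_all add: m)
  qed
  ultimately show "((\<lambda>t. real l * (1 - t) ^ (l - 1) * t ^ k) has_integral 1 / real ((l + k) choose k)) {0<..<1}"
    by (simp add: mult_ac)
qed auto

text \<open>The antiderivative is \<open>- ((1 - t) ^ l)\<close>, which vanishes at 1 because
  \<open>1 \<le> l\<close>.\<close>

lemma nn_integral_power_tail:
  assumes "1 \<le> l" "0 \<le> \<tau>" "\<tau> \<le> 1"
  shows "(\<integral>\<^sup>+t. ennreal (real l * (1 - t) ^ (l - 1)) * indicator {\<tau>..1} t \<partial>lborel) = ennreal ((1 - \<tau>) ^ l)"
proof (rule nn_integral_has_integral_lebesgue')
  have "((\<lambda>t. - ((1 - t) ^ l)) has_vector_derivative real l * (1 - t) ^ (l - 1)) (at t within {\<tau>..1})" for t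
    by (auto intro!: derivative_eq_intros simp flip: has_real_derivative_iff_has_vector_derivative)
  from fundamental_theorem_of_calculus[OF assms(3) this]
  show "((\<lambda>t. real l * (1 - t) ^ (l - 1)) has_integral (1 - \<tau>) ^ l) {\<tau>..1}"
    using assms(1) by (simp add: power_0_left)
qed (use assms in auto)

text \<open>Since \<open>T\<close> lies in the interval from \<open>Inf T\<close> to 1, the integral
  is at most \<open>(1 - Inf T) ^ l\<close>. The bound by \<open>y\<close> extends from
  \<open>T\<close> to its closure by continuity, so it also holds at \<open>Inf T\<close> when the
  infimum is not attained.\<close>

lemma nn_integral_power_weight_le:
  fixes T :: "real set" and y :: ennreal
  assumes "1 \<le> l" and T: "T \<subseteq> {0<..<1}"
    and y: "\<And>t. t \<in> T \<Longrightarrow> ennreal ((1 - t) ^ l) \<le> y"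
  shows "(\<integral>\<^sup>+t. ennreal (real l * (1 - t) ^ (l - 1)) * indicator T t \<partial>lborel) \<le> y"
proof (cases "T = {} \<or> y = top")
  case False
  then obtain t0 r where t0: "t0 \<in> T" and r: "y = ennreal r" "0 \<le> r"
    by (cases y) auto
  have bdd: "bdd_below T" using T by (auto intro!: bdd_belowI[of _ 0])
  have *: "(1 - t) ^ l \<le> r" if "t \<in> T" for t
    using y[OF that] T that r by (auto simp: ennreal_le_iff)
  have "closure T \<subseteq> {t. (1 - t) ^ l \<le> r}"
    using * by (intro closure_minimal closed_Collect_le continuous_intros) auto
  then have Inf: "(1 - Inf T) ^ l \<le> r"
    using closure_contains_Inf[OF _ bdd] t0 by blast
  have "(\<integral>\<^sup>+t. ennreal (real l * (1 - t) ^ (l - 1)) * indicator T t \<partial>lborel)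
      \<le> (\<integral>\<^sup>+t. ennreal (real l * (1 - t) ^ (l - 1)) * indicator {Inf T..1} t \<partial>lborel)"
    using cInf_lower[OF _ bdd] T
    by (intro nn_integral_mono) (auto simp: indicator_def subset_eq less_imp_le)
  also have "\<dots> = ennreal ((1 - Inf T) ^ l)"
  proof (rule nn_integral_power_tail[OF \<open>1 \<le> l\<close>])
    show "0 \<le> Inf T" using t0 T by (intro cInf_greatest) auto
    show "Inf T \<le> 1" using cInf_lower[OF t0 bdd] t0 T by auto
  qed
  also have "\<dots> \<le> y" using Inf r by (simp add: ennreal_leI)
  finally show ?thesis .
qed auto

text \<open>Write \<open>\<tau>\<close> for the gauge of \<open>C\<close>. The hypothesis says that \<open>g\<close> dominates \<open>m * (1 - \<tau>) ^ l\<close>,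
  whose integral is computed by the layer-cake formula and the beta integral.\<close>

lemma emeasure_le_nn_integral_of_star_bound:
  fixes g :: "'a::euclidean_space \<Rightarrow> ennreal" and m :: ennreal
  assumes E: "subspace E" and l: "1 \<le> l"
    and C [measurable]: "C \<in> sets borel" and g [measurable]: "g \<in> borel_measurable borel"
    and m: "m \<noteq> 0" "m \<noteq> top"
    and bound: "\<And>t c. 0 < t \<Longrightarrow> t < 1 \<Longrightarrow> c \<in> C \<Longrightarrow> m * ennreal ((1 - t) ^ l) \<le> g (t *\<^sub>R c)"
  shows "m * emeasure (subspace_lborel E) C
       \<le> of_nat ((l + dim E) choose dim E) * (\<integral>\<^sup>+z. g z \<partial>subspace_lborel E)"
proof -
  interpret E: invariant_measure "subspace_lborel E" E by (rule invariant_subspace_lborel[OF E])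
  interpret EL: pair_sigma_finite "subspace_lborel E" "lborel :: real measure" ..
  let ?b = "(l + dim E) choose dim E"
  let ?w = "\<lambda>t::real. ennreal (real l * (1 - t) ^ (l - 1))"
  have b: "0 < ?b" by simp
  have "emeasure (subspace_lborel E) C * ennreal (1 / real ?b)
      = (\<integral>\<^sup>+t. emeasure (subspace_lborel E) C *
            (ennreal (real l * (1 - t) ^ (l - 1) * t ^ dim E) * indicator {0<..<1} t) \<partial>lborel)"
    unfolding nn_integral_beta_weight[OF l, symmetric]
    by (rule nn_integral_cmult[symmetric]) measurable
  \<comment> \<open>The factor \<open>t ^ dim E\<close> is absorbed by the dilate of
    \<open>C\<close>: the condition \<open>z /\<^sub>R t \<in> C\<close> says that \<open>z\<close>
    lies in \<open>t\<close> times \<open>C\<close>.\<close>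
  also have "\<dots> = (\<integral>\<^sup>+t. \<integral>\<^sup>+z. ?w t * indicator {0<..<1} t * indicator C (z /\<^sub>R t) \<partial>subspace_lborel E \<partial>lborel)"
  proof (rule nn_integral_cong)
    fix t :: real
    show "emeasure (subspace_lborel E) C * (ennreal (real l * (1 - t) ^ (l - 1) * t ^ dim E) * indicator {0<..<1} t)
        = (\<integral>\<^sup>+z. ?w t * indicator {0<..<1} t * indicator C (z /\<^sub>R t) \<partial>subspace_lborel E)"
    proof (cases "0 < t \<and> t < 1")
      case True
      have "(\<integral>\<^sup>+z. ?w t * indicator {0<..<1} t * indicator C (z /\<^sub>R t) \<partial>subspace_lborel E)
          = ?w t * indicator {0<..<1} t * (\<integral>\<^sup>+z. indicator C (z /\<^sub>R t) \<partial>subspace_lborel E)"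
        by (rule nn_integral_cmult) measurable
      also have "(\<integral>\<^sup>+z. indicator C (z /\<^sub>R t) \<partial>subspace_lborel E) = ennreal t ^ dim E * emeasure (subspace_lborel E) C"
        using True by (subst nn_integral_subspace_lborel_scale[OF E]) simp_all
      finally show ?thesis
        using True by (simp add: ennreal_mult ennreal_power mult_ac)
    qed auto
  qed
  also have "\<dots> = (\<integral>\<^sup>+z. \<integral>\<^sup>+t. ?w t * indicator {0<..<1} t * indicator C (z /\<^sub>R t) \<partial>lborel \<partial>subspace_lborel E)"
    by (rule EL.Fubini') measurable
  also have "\<dots> \<le> (\<integral>\<^sup>+z. g z / m \<partial>subspace_lborel E)"
  proof (rule nn_integral_mono)
    fix z
    have "(\<integral>\<^sup>+t. ?w t * indicator {0<..<1} t * indicator C (z /\<^sub>R t) \<partial>lborel)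
        = (\<integral>\<^sup>+t. ?w t * indicator {t \<in> {0<..<1}. z /\<^sub>R t \<in> C} t \<partial>lborel)"
      by (intro nn_integral_cong) (auto simp: indicator_def)
    also have "\<dots> \<le> g z / m"
    \<comment> \<open>For fixed \<open>z\<close> the relevant \<open>t\<close> are those whose
      dilate of \<open>C\<close> contains \<open>z\<close>; \<open>bound\<close> is used with
      \<open>c = z /\<^sub>R t\<close>.\<close>
    proof (rule nn_integral_power_weight_le[OF l])
      fix t assume t: "t \<in> {t \<in> {0<..<1}. z /\<^sub>R t \<in> C}"
      then have "m * ennreal ((1 - t) ^ l) \<le> g z"
        using bound[of t "z /\<^sub>R t"] by simp
      then have "(ennreal ((1 - t) ^ l) * m) / m \<le> g z / m"
        by (intro divide_right_mono_ennreal) (simp add: mult.commute)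
      then show "ennreal ((1 - t) ^ l) \<le> g z / m"
        using m by (simp add: mult_divide_eq_ennreal)
    qed auto
    finally show "(\<integral>\<^sup>+t. ?w t * indicator {0<..<1} t * indicator C (z /\<^sub>R t) \<partial>lborel) \<le> g z / m" .
  qed
  also have "\<dots> = (\<integral>\<^sup>+z. g z \<partial>subspace_lborel E) / m"
    by (rule nn_integral_divide) measurable
  finally have "of_nat ?b * m * (emeasure (subspace_lborel E) C * ennreal (1 / real ?b))
      \<le> of_nat ?b * m * ((\<integral>\<^sup>+z. g z \<partial>subspace_lborel E) / m)"
    by (rule mult_left_mono) simp
  moreover have "of_nat ?b * ennreal (1 / real ?b) = 1"
    using b by (simp add: ennreal_of_nat_eq_real_of_nat flip: ennreal_mult)
  then have "of_nat ?b * m * (emeasure (subspace_lborel E) C * ennreal (1 / real ?b))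
      = m * emeasure (subspace_lborel E) C"
    by (metis (no_types, lifting) mult.assoc mult.commute mult.right_neutral)
  moreover have "m * ((\<integral>\<^sup>+z. g z \<partial>subspace_lborel E) / m) = (\<integral>\<^sup>+z. g z \<partial>subspace_lborel E)"
    using m by (simp add: ennreal_mult_divide_eq ennreal_times_divide mult.commute[of m])
  ultimately show ?thesis
    by (simp add: mult.assoc)
qed

section \<open>Integrating the covariogram over \<open>E\<close>, and maximal slices\<close>

text \<open>Write the covariogram as an integral over \<open>y\<close> in \<open>F\<close>, exchange
  the integrals, and split \<open>y = x + e\<close> along the complement and \<open>E\<close>. For
  fixed \<open>x\<close> the remaining double integral over \<open>E\<close> factors into two slice
  volumes.\<close>

lemma nn_integral_emeasure_Int_reflected:
  fixes E F P Q :: "'a::euclidean_space set"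
  assumes E: "subspace E" and F: "subspace F" and EF: "E \<subseteq> F"
    and P [measurable]: "P \<in> sets borel" and Q [measurable]: "Q \<in> sets borel"
  shows "(\<integral>\<^sup>+z. emeasure (subspace_lborel F) (P \<inter> (\<lambda>y. z - y) -` Q) \<partial>subspace_lborel E)
       = (\<integral>\<^sup>+x. emeasure (subspace_lborel E) ((+) x -` P)
               * emeasure (subspace_lborel E) ((+) x -` uminus -` Q) \<partial>subspace_lborel (F \<inter> E\<^sup>\<bottom>))"
proof -
  let ?E = "subspace_lborel E" and ?F = "subspace_lborel F" and ?G = "subspace_lborel (F \<inter> E\<^sup>\<bottom>)"
  interpret E: invariant_measure ?E E by (rule invariant_subspace_lborel[OF E])
  interpret F: invariant_measure ?F F by (rule invariant_subspace_lborel[OF F])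
  interpret FE: pair_sigma_finite ?F ?E ..
  have "(\<integral>\<^sup>+z. emeasure ?F (P \<inter> (\<lambda>y. z - y) -` Q) \<partial>?E)
      = (\<integral>\<^sup>+z. \<integral>\<^sup>+y. indicator P y * indicator Q (z - y) \<partial>?F \<partial>?E)"
  proof (rule nn_integral_cong)
    fix z
    have "P \<inter> (\<lambda>y. z - y) -` Q \<in> sets borel"
      using measurable_sets[of "\<lambda>y. z - y" borel borel Q] by auto
    then have "emeasure ?F (P \<inter> (\<lambda>y. z - y) -` Q) = (\<integral>\<^sup>+y. indicator (P \<inter> (\<lambda>y. z - y) -` Q) y \<partial>?F)"
      by simp
    also have "\<dots> = (\<integral>\<^sup>+y. indicator P y * indicator Q (z - y) \<partial>?F)"
      by (intro nn_integral_cong) (auto simp: indicator_def)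
    finally show "emeasure ?F (P \<inter> (\<lambda>y. z - y) -` Q) = (\<integral>\<^sup>+y. indicator P y * indicator Q (z - y) \<partial>?F)" .
  qed
  also have "\<dots> = (\<integral>\<^sup>+y. \<integral>\<^sup>+z. indicator P y * indicator Q (z - y) \<partial>?E \<partial>?F)"
    by (rule FE.Fubini') measurable
  also have "\<dots> = (\<integral>\<^sup>+x. \<integral>\<^sup>+e. \<integral>\<^sup>+z. indicator P (x + e) * indicator Q (z - (x + e)) \<partial>?E \<partial>?E \<partial>?G)"
    by (rule nn_integral_subspace_lborel_decomp[OF E F EF]) measurable
  also have "\<dots> = (\<integral>\<^sup>+x. emeasure ?E ((+) x -` P) * emeasure ?E ((+) x -` uminus -` Q) \<partial>?G)"
  proof (rule nn_integral_cong)
    fix x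
    have P': "(+) x -` P \<in> sets borel"
      using measurable_sets[of "(+) x" borel borel P] by simp
    have Q': "(+) x -` uminus -` Q \<in> sets borel"
      using measurable_sets[of "\<lambda>z. - (x + z)" borel borel Q] by (simp add: vimage_def)
    have "(\<integral>\<^sup>+e. \<integral>\<^sup>+z. indicator P (x + e) * indicator Q (z - (x + e)) \<partial>?E \<partial>?E)
        = (\<integral>\<^sup>+e. indicator ((+) x -` P) e * emeasure ?E ((+) x -` uminus -` Q) \<partial>?E)"
    proof (rule nn_integral_cong_AE, use E.AE_mem in eventually_elim)
      fix e assume "e \<in> E"
      have "(\<integral>\<^sup>+z. indicator P (x + e) * indicator Q (z - (x + e)) \<partial>?E)
          = indicator P (x + e) * (\<integral>\<^sup>+z. indicator Q (z - (x + e)) \<partial>?E)"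
        by (rule nn_integral_cmult) measurable
      \<comment> \<open>Replacing \<open>z\<close> by \<open>e - z\<close> turns the argument into
        \<open>- (x + z)\<close>, which no longer involves \<open>e\<close>; this decouples the two
        integrals.\<close>
      also have "(\<integral>\<^sup>+z. indicator Q (z - (x + e)) \<partial>?E) = (\<integral>\<^sup>+z. indicator Q ((e - z) - (x + e)) \<partial>?E)"
        by (rule E.nn_integral_translate_reflect[symmetric]) (use \<open>e \<in> E\<close> in measurable)
      also have "\<dots> = (\<integral>\<^sup>+z. indicator ((+) x -` uminus -` Q) z \<partial>?E)"
        by (intro nn_integral_cong) (auto simp: indicator_def algebra_simps)
      also have "\<dots> = emeasure ?E ((+) x -` uminus -` Q)"
        using Q' by simp
      finally show "(\<integral>\<^sup>+z. indicator P (x + e) * indicator Q (z - (x + e)) \<partial>?E)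
          = indicator ((+) x -` P) e * emeasure ?E ((+) x -` uminus -` Q)"
        by (simp add: indicator_def)
    qed
    also have "\<dots> = emeasure ?E ((+) x -` P) * emeasure ?E ((+) x -` uminus -` Q)"
      using P' by (simp add: nn_integral_multc)
    finally show "(\<integral>\<^sup>+e. \<integral>\<^sup>+z. indicator P (x + e) * indicator Q (z - (x + e)) \<partial>?E \<partial>?E)
        = emeasure ?E ((+) x -` P) * emeasure ?E ((+) x -` uminus -` Q)" .
  qed
  finally show ?thesis .
qed

lemma vimage_translate_borel [simp]:
  fixes Q :: "'a::euclidean_space set"
  assumes "Q \<in> sets borel"
  shows "(+) x -` Q \<in> sets borel"
  using measurable_sets[of "(+) x" borel borel Q] assms by simp

lemma borel_measurable_emeasure_slice:
  fixes E Q :: "'a::euclidean_space set"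
  assumes E: "subspace E" and Q [measurable]: "Q \<in> sets borel"
  shows "(\<lambda>x. emeasure (subspace_lborel E) ((+) x -` Q)) \<in> borel_measurable borel"
proof -
  interpret E: invariant_measure "subspace_lborel E" E by (rule invariant_subspace_lborel[OF E])
  have "(\<lambda>x. \<integral>\<^sup>+e. indicator Q (x + e) \<partial>subspace_lborel E) \<in> borel_measurable borel"
    by measurable
  moreover have "(\<integral>\<^sup>+e. indicator Q (x + e) \<partial>subspace_lborel E) = emeasure (subspace_lborel E) ((+) x -` Q)" for x
  proof -
    have "(\<integral>\<^sup>+e. indicator Q (x + e) \<partial>subspace_lborel E) = (\<integral>\<^sup>+e. indicator ((+) x -` Q) e \<partial>subspace_lborel E)"
      by (intro nn_integral_cong) (auto simp: indicator_def)
    then show ?thesis by simp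
  qed
  ultimately show ?thesis by simp
qed

text \<open>Slice volumes of a compact set are upper semicontinuous by the reverse Fatou lemma.\<close>

lemma slice_volume_attains_max:
  fixes E F Q :: "'a::euclidean_space set"
  assumes E: "subspace E" and F: "subspace F" and EF: "E \<subseteq> F" and Q: "compact Q" "Q \<subseteq> F"
  obtains x0 where "x0 \<in> F"
    "\<And>x. x \<in> F \<Longrightarrow> emeasure (subspace_lborel E) ((+) x -` Q) \<le> emeasure (subspace_lborel E) ((+) x0 -` Q)"
proof (cases "Q = {}")
  case True
  then show thesis using that[of 0] subspace_0[OF F] by simp
next
  case False
  let ?E = "subspace_lborel E" and ?\<phi> = "\<lambda>x. emeasure (subspace_lborel E) ((+) x -` Q)"
  interpret E: invariant_measure ?E E by (rule invariant_subspace_lborel[OF E])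
  have clQ: "closed Q" using Q by (simp add: compact_imp_closed)
  then have Qb [measurable]: "Q \<in> sets borel" by simp
  \<comment> \<open>The supremum is first taken over base points in \<open>Q\<close>, where
    compactness gives a convergent maximizing subsequence. Other points of \<open>F\<close> are
    reduced to this case at the end.\<close>
  obtain f :: "nat \<Rightarrow> ennreal" where f: "incseq f" "range f \<subseteq> ?\<phi> ` Q" "(SUP x\<in>Q. ?\<phi> x) = (SUP i. f i)"
    using ennreal_Sup_countable_SUP[of "?\<phi> ` Q"] False by auto
  then have "\<forall>n. \<exists>x\<in>Q. f n = ?\<phi> x" by blast
  then obtain X where X: "\<And>n. X n \<in> Q" "\<And>n. f n = ?\<phi> (X n)" by metis
  obtain x0 r where x0: "x0 \<in> Q" "strict_mono r" "(X \<circ> r) \<longlonglongrightarrow> x0"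
    using \<open>compact Q\<close> X(1) unfolding compact_def by blast
  have lim: "(\<lambda>n. ?\<phi> (X (r n))) \<longlonglongrightarrow> (SUP x\<in>Q. ?\<phi> x)"
    using LIMSEQ_subseq_LIMSEQ[OF LIMSEQ_SUP[OF f(1)] x0(2)] by (simp add: f(3) X(2) o_def)
  \<comment> \<open>All slices with base point in \<open>Q\<close> lie in the bounded set
    \<open>D\<close>, whose indicator is the integrable majorant for reverse Fatou.\<close>
  define D where "D = {x - y |x y. x \<in> Q \<and> y \<in> Q}"
  have "compact D" unfolding D_def by (rule compact_differences) (use Q in auto)
  then have D [measurable]: "D \<in> sets borel" "emeasure ?E D < \<infinity>"
    using emeasure_subspace_lborel_finite[OF E] by (auto simp: compact_imp_bounded compact_imp_closed)
  have ind: "?\<phi> x = (\<integral>\<^sup>+e. indicator ((+) x -` Q) e \<partial>?E)" for x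
    by simp
  have "(SUP x\<in>Q. ?\<phi> x) = limsup (\<lambda>n. ?\<phi> (X (r n)))"
    using lim_imp_Limsup[OF _ lim] by simp
  also have "\<dots> \<le> (\<integral>\<^sup>+e. limsup (\<lambda>n. indicator ((+) (X (r n)) -` Q) e) \<partial>?E)"
    unfolding ind
  proof (rule nn_integral_limsup[where w = "indicator D"])
    show "AE e in ?E. indicator ((+) (X (r n)) -` Q) e \<le> (indicator D e :: ennreal)" for n
    proof (rule AE_I2)
      fix e
      have "e \<in> D" if "X (r n) + e \<in> Q"
        unfolding D_def using that X(1)[of "r n"] by (intro CollectI exI[of _ "X (r n) + e"] exI[of _ "X (r n)"]) simp
      then show "indicator ((+) (X (r n)) -` Q) e \<le> (indicator D e :: ennreal)"
        by (auto simp: indicator_def)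
    qed
  qed (use D in simp_all)
  also have "\<dots> \<le> (\<integral>\<^sup>+e. indicator ((+) x0 -` Q) e \<partial>?E)"
  proof (intro nn_integral_mono Limsup_bounded)
    fix e
    show "\<forall>\<^sub>F n in sequentially. indicator ((+) (X (r n)) -` Q) e \<le> (indicator ((+) x0 -` Q) e :: ennreal)"
    proof (cases "x0 + e \<in> Q")
      \<comment> \<open>The complement of \<open>Q\<close> is open, so a point missing the limiting
        slice misses all but finitely many slices of the sequence.\<close>
      case False
      have "(\<lambda>n. X (r n) + e) \<longlonglongrightarrow> x0 + e"
        using x0(3) by (intro tendsto_add) (auto simp: o_def)
      then have "\<forall>\<^sub>F n in sequentially. X (r n) + e \<in> - Q"
        using clQ False by (intro topological_tendstoD) auto
      then show ?thesis by eventually_elim (simp add: indicator_def)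
    qed (simp add: indicator_def)
  qed
  finally have SUP: "(SUP x\<in>Q. ?\<phi> x) \<le> ?\<phi> x0" by simp
  show thesis
  proof (rule that[of x0])
    show "x0 \<in> F" using x0 Q by auto
    fix x assume "x \<in> F"
    show "?\<phi> x \<le> ?\<phi> x0"
    \<comment> \<open>A slice that meets \<open>Q\<close> can be based at a point of
      \<open>Q\<close> by a translation within \<open>E\<close>, preserving its volume; one that
      misses \<open>Q\<close> has volume 0.\<close>
    proof (cases "\<exists>e\<in>E. x + e \<in> Q")
      case True
      then obtain e where e: "e \<in> E" "x + e \<in> Q" by auto
      have "(+) x -` Q = (+) e ` ((+) (x + e) -` Q)"
        by (auto simp: image_iff add_ac intro!: bexI[of _ "_ - e"])
      then have "?\<phi> x = ?\<phi> (x + e)"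
        using E.emeasure_translate[of "(+) (x + e) -` Q" e] e by simp
      also have "\<dots> \<le> ?\<phi> x0"
        using SUP SUP_upper[OF e(2), of ?\<phi>] by (rule order_trans[rotated])
      finally show ?thesis .
    next
      case False
      then have "(+) x -` Q \<inter> E = {}" by auto
      then show ?thesis using E.emeasure_Int_S[of "(+) x -` Q"] by simp
    qed
  qed
qed

lemma borel_measurable_emeasure_Int_reflected:
  fixes F P Q :: "'a::euclidean_space set"
  assumes F: "subspace F" and P [measurable]: "P \<in> sets borel" and Q [measurable]: "Q \<in> sets borel"
  shows "(\<lambda>z. emeasure (subspace_lborel F) (P \<inter> (\<lambda>y. z - y) -` Q)) \<in> borel_measurable borel"
proof -
  interpret F: invariant_measure "subspace_lborel F" F by (rule invariant_subspace_lborel[OF F])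
  have "(\<lambda>z. \<integral>\<^sup>+y. indicator P y * indicator Q (z - y) \<partial>subspace_lborel F) \<in> borel_measurable borel"
    by measurable
  moreover have "(\<integral>\<^sup>+y. indicator P y * indicator Q (z - y) \<partial>subspace_lborel F)
      = emeasure (subspace_lborel F) (P \<inter> (\<lambda>y. z - y) -` Q)" for z
  proof -
    have "P \<inter> (\<lambda>y. z - y) -` Q \<in> sets borel"
      using measurable_sets[of "\<lambda>y. z - y" borel borel Q] by auto
    moreover have "(\<integral>\<^sup>+y. indicator P y * indicator Q (z - y) \<partial>subspace_lborel F)
        = (\<integral>\<^sup>+y. indicator (P \<inter> (\<lambda>y. z - y) -` Q) y \<partial>subspace_lborel F)"
      by (intro nn_integral_cong) (auto simp: indicator_def)
    ultimately show ?thesis by simp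
  qed
  ultimately show ?thesis by simp
qed

text \<open>The integrand is at most the finite volume of \<open>P\<close> and vanishes outside the
  compact Minkowski sum \<open>D\<close>. Finiteness later permits the passage from
  \<open>ennreal\<close> to real numbers.\<close>

lemma nn_integral_emeasure_Int_reflected_finite:
  fixes E F P Q :: "'a::euclidean_space set"
  assumes E: "subspace E" and F: "subspace F" and P: "compact P" and Q: "compact Q"
  shows "(\<integral>\<^sup>+z. emeasure (subspace_lborel F) (P \<inter> (\<lambda>y. z - y) -` Q) \<partial>subspace_lborel E) < \<infinity>"
proof -
  define D where "D = {x + y |x y. x \<in> P \<and> y \<in> Q}"
  have D: "compact D" unfolding D_def by (rule compact_sums[OF P Q])
  then have Db: "D \<in> sets borel" by (simp add: compact_imp_closed)
  have Pb: "P \<in> sets borel" using P by (simp add: compact_imp_closed)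
  have "(\<integral>\<^sup>+z. emeasure (subspace_lborel F) (P \<inter> (\<lambda>y. z - y) -` Q) \<partial>subspace_lborel E)
      \<le> (\<integral>\<^sup>+z. emeasure (subspace_lborel F) P * indicator D z \<partial>subspace_lborel E)"
  proof (rule nn_integral_mono)
    fix z
    show "emeasure (subspace_lborel F) (P \<inter> (\<lambda>y. z - y) -` Q) \<le> emeasure (subspace_lborel F) P * indicator D z"
    proof (cases "z \<in> D")
      case True
      then show ?thesis using Pb by (auto intro!: emeasure_mono)
    next
      case False
      have "P \<inter> (\<lambda>y. z - y) -` Q = {}"
      proof (rule ccontr)
        assume "P \<inter> (\<lambda>y. z - y) -` Q \<noteq> {}"
        then obtain y where "y \<in> P" "z - y \<in> Q" by auto
        then have "z \<in> D" unfolding D_def by (intro CollectI exI[of _ y] exI[of _ "z - y"]) simp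
        with False show False ..
      qed
      then show ?thesis by simp
    qed
  qed
  also have "\<dots> = emeasure (subspace_lborel F) P * emeasure (subspace_lborel E) D"
    using Db by (simp add: nn_integral_cmult)
  also have "\<dots> < \<infinity>"
    using emeasure_subspace_lborel_finite[OF F compact_imp_bounded[OF P] Pb]
      emeasure_subspace_lborel_finite[OF E compact_imp_bounded[OF D] Db]
    by (simp add: ennreal_mult_less_top)
  finally show ?thesis .
qed

text \<open>For \<open>a \<in> K\<close> and \<open>b \<in> L\<close> with \<open>a + b \<in> E\<close> the body \<open>K \<inter> (t(a + b) - L)\<close> contains
  \<open>(1 - t)(K \<inter> (-L)) + ta\<close>.\<close>

lemma emeasure_sum_section_le:
  fixes E F K L :: "'a::euclidean_space set"
  assumes E: "subspace E" and F: "subspace F" and EF: "E \<subseteq> F" and l: "1 \<le> dim F"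
    and K: "compact K" "convex K" and L: "compact L" "convex L"
    and pos: "emeasure (subspace_lborel F) (orth_proj F ` (K \<inter> uminus ` L)) \<noteq> 0"
  shows "emeasure (subspace_lborel F) (orth_proj F ` (K \<inter> uminus ` L))
           * emeasure (subspace_lborel E) ((K + L) \<inter> E)
       \<le> of_nat ((dim F + dim E) choose dim E)
           * (\<integral>\<^sup>+z. emeasure (subspace_lborel F) (orth_proj F ` K \<inter> (\<lambda>y. z - y) -` (orth_proj F ` L))
                \<partial>subspace_lborel E)"
proof (rule emeasure_le_nn_integral_of_star_bound[OF E l _ _ pos])
  let ?F = "subspace_lborel F" and ?W = "orth_proj F ` (K \<inter> uminus ` L)"
  interpret F: invariant_measure ?F F by (rule invariant_subspace_lborel[OF F])
  interpret linear "orth_proj F" by (rule linear_orth_proj[OF F])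
  have W: "compact ?W"
    using compact_orth_proj[OF F] compact_Int[OF K(1) compact_negations[OF L(1)]] by auto
  then have Wb: "?W \<in> sets borel" by (simp add: compact_imp_closed)
  have P: "orth_proj F ` K \<in> sets borel" "orth_proj F ` L \<in> sets borel"
    using compact_orth_proj[OF F] K L by (auto simp: compact_imp_closed)
  show "(\<lambda>z. emeasure ?F (orth_proj F ` K \<inter> (\<lambda>y. z - y) -` (orth_proj F ` L))) \<in> borel_measurable borel"
    by (rule borel_measurable_emeasure_Int_reflected[OF F P])
  have "compact (K + L)"
    using compact_sums[OF K(1) L(1)] by (simp add: set_plus_def Bex_def conj_ac)
  then show "(K + L) \<inter> E \<in> sets borel"
    using closed_subspace[OF E] by (simp add: compact_imp_closed closed_Int)
  show "emeasure ?F ?W \<noteq> top"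
    using emeasure_subspace_lborel_finite[OF F compact_imp_bounded[OF W] Wb] by simp
  fix t :: real and c assume t: "0 < t" "t < 1" and c: "c \<in> (K + L) \<inter> E"
  then obtain a b where ab: "a \<in> K" "b \<in> L" "c = a + b"
    by (auto elim: set_plus_elim)
  have tF: "t *\<^sub>R orth_proj F a \<in> F"
    by (intro subspace_scale[OF F] orth_proj_mem(1)[OF F])
  have tc: "orth_proj F (t *\<^sub>R c) = t *\<^sub>R c"
    using c EF by (intro orth_proj_id[OF F] subspace_scale[OF F]) auto
  let ?A = "(*\<^sub>R) (1 - t) ` ?W"
  have A: "?A \<in> sets borel"
    using compact_scaling[OF W, of "1 - t"] by (simp add: compact_imp_closed)
  have "emeasure ?F ?W * ennreal ((1 - t) ^ dim F) = emeasure ?F ?A"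
    using t by (subst emeasure_subspace_lborel_scale[OF F _ Wb]) (simp_all add: mult.commute ennreal_power)
  also have "\<dots> = emeasure ?F ((+) (t *\<^sub>R orth_proj F a) ` ?A)"
    by (rule F.emeasure_translate[OF A tF, symmetric])
  also have "\<dots> \<le> emeasure ?F (orth_proj F ` K \<inter> (\<lambda>y. t *\<^sub>R c - y) -` (orth_proj F ` L))"
  proof (rule emeasure_mono)
    show "orth_proj F ` K \<inter> (\<lambda>y. t *\<^sub>R c - y) -` (orth_proj F ` L) \<in> sets ?F"
      using measurable_sets[of "\<lambda>y. t *\<^sub>R c - y" borel borel "orth_proj F ` L"] P by auto
    show "(+) (t *\<^sub>R orth_proj F a) ` ?A \<subseteq> orth_proj F ` K \<inter> (\<lambda>y. t *\<^sub>R c - y) -` (orth_proj F ` L)"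
    proof
      fix y assume "y \<in> (+) (t *\<^sub>R orth_proj F a) ` ?A"
      then obtain w where w: "w \<in> K" "- w \<in> L"
        and y: "y = t *\<^sub>R orth_proj F a + (1 - t) *\<^sub>R orth_proj F w"
        by (auto simp: image_iff)
      have y': "y = orth_proj F (t *\<^sub>R a + (1 - t) *\<^sub>R w)"
        by (simp add: y add scale)
      have "t *\<^sub>R a + (1 - t) *\<^sub>R w \<in> K"
        using convexD[OF K(2) ab(1) w(1), of t "1 - t"] t by simp
      moreover have "t *\<^sub>R b + (1 - t) *\<^sub>R (- w) \<in> L"
        using convexD[OF L(2) ab(2) w(2), of t "1 - t"] t by simp
      \<comment> \<open>As \<open>c \<in> E\<close> and \<open>E \<subseteq> F\<close>, the
        projection fixes \<open>t *\<^sub>R c\<close>. Substituting \<open>c = a + b\<close> leaves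
        the convex combination of \<open>b\<close> and \<open>- w\<close>, both in
        \<open>L\<close>.\<close>
      moreover have "t *\<^sub>R c - y = orth_proj F (t *\<^sub>R b + (1 - t) *\<^sub>R (- w))"
        unfolding y' by (subst tc[symmetric]) (simp add: ab(3) algebra_simps flip: diff)
      ultimately show "y \<in> orth_proj F ` K \<inter> (\<lambda>y. t *\<^sub>R c - y) -` (orth_proj F ` L)"
        by (auto simp: y')
    qed
  qed
  finally show "emeasure ?F ?W * ennreal ((1 - t) ^ dim F)
      \<le> emeasure ?F (orth_proj F ` K \<inter> (\<lambda>y. t *\<^sub>R c - y) -` (orth_proj F ` L))" .
qed

section \<open>Real-valued volumes, attained maxima and the choice of intermediate subspaces\<close>

lemma flat_volume_eq_measure_slice:
  fixes E Q :: "'a::euclidean_space set"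
  assumes E: "subspace E" and Q: "Q \<in> sets borel"
  shows "flat_volume E x (Q \<inter> (+) x ` E) = measure (subspace_lborel E) ((+) x -` Q)"
proof -
  interpret E: invariant_measure "subspace_lborel E" E by (rule invariant_subspace_lborel[OF E])
  have "(\<lambda>y. y - x) ` (Q \<inter> (+) x ` E) = ((+) x -` Q) \<inter> E"
    by (auto simp: image_iff intro!: bexI[of _ "x + _"])
  then show ?thesis
    using E.emeasure_Int_S[of "(+) x -` Q"] Q
    by (simp add: flat_volume_def subspace_volume_def measure_def)
qed

lemma emeasure_slice_eq_measure:
  fixes E Q :: "'a::euclidean_space set"
  assumes E: "subspace E" and Q: "compact Q"
  shows "emeasure (subspace_lborel E) ((+) x -` Q) = ennreal (measure (subspace_lborel E) ((+) x -` Q))"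
proof -
  have "(+) x -` Q = (+) (- x) ` Q"
    by (force simp: image_iff)
  then have "bounded ((+) x -` Q)"
    using compact_imp_bounded[OF compact_translation[OF Q, of "- x"]] by simp
  then show ?thesis
    using emeasure_subspace_lborel_finite[OF E, of "(+) x -` Q"] Q
    by (intro emeasure_eq_ennreal_measure) (simp add: compact_imp_closed)
qed

lemma orth_proj_uminus_image:
  fixes F L :: "'a::euclidean_space set"
  assumes F: "subspace F"
  shows "orth_proj F ` uminus ` L = uminus -` (orth_proj F ` L)"
proof -
  interpret linear "orth_proj F" by (rule linear_orth_proj[OF F])
  have "(\<exists>x\<in>L. y = - orth_proj F x) \<longleftrightarrow> (\<exists>x\<in>L. - y = orth_proj F x)" for y
    by (metis minus_minus)
  then show ?thesis by (auto simp: image_iff neg)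
qed

lemma maximum_overI:
  assumes "s \<in> S" "\<And>x. x \<in> S \<Longrightarrow> f x \<le> f s"
  shows "maximum_over S f = f s"
  unfolding maximum_over_def by (rule Greatest_equality) (use assms in auto)

text \<open>For interior points \<open>x\<close> of \<open>K\<close> and \<open>y\<close> of
  \<open>L\<close>, the choice \<open>z = x + y\<close> makes \<open>x\<close> interior to both
  \<open>K\<close> and \<open>z - L\<close>. Hence the maximum in the denominator is
  positive.\<close>

lemma proj_inter_volume_pos:
  fixes F K L :: "'a::euclidean_space set"
  assumes F: "subspace F" and K: "convex_body K" and L: "convex_body L"
  obtains z where "0 < proj_inter_volume F K L z"
proof -
  obtain x y where xy: "x \<in> interior K" "y \<in> interior L"
    using K L by (auto simp: convex_body_def)
  let ?L = "(\<lambda>v. (x + y) - v) ` L"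
  have eq: "?L = (+) (x + y) ` uminus ` L"
    by (auto simp: image_iff)
  have "x \<in> interior ?L"
    unfolding eq interior_translation interior_negations using xy(2)
    by (auto simp: image_iff intro!: bexI[of _ y])
  then have "interior (K \<inter> ?L) \<noteq> {}"
    using xy by auto
  moreover have c: "compact (K \<inter> ?L)"
    unfolding eq using K L by (auto simp: convex_body_def intro!: compact_Int compact_translation compact_negations)
  ultimately have "0 < emeasure (subspace_lborel F) (orth_proj F ` (K \<inter> ?L))"
    by (intro emeasure_orth_proj_pos[OF F])
  moreover have "emeasure (subspace_lborel F) (orth_proj F ` (K \<inter> ?L)) < \<infinity>"
    using compact_orth_proj[OF F c]
    by (intro emeasure_subspace_lborel_finite[OF F]) (auto simp: compact_imp_bounded compact_imp_closed)
  ultimately have "0 < proj_inter_volume F K L (x + y)"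
    by (simp add: proj_inter_volume_def subspace_volume_def measure_def enn2real_positive_iff)
  then show thesis by (rule that)
qed

text \<open>A subspace \<open>T\<close> of the complement of \<open>E\<close> with codimension
  \<open>l\<close> has an orthogonal complement of dimension \<open>l\<close> containing
  \<open>E\<close>. The infimum in the theorem thus ranges over a nonempty family.\<close>

lemma ex_subspace_between_dim:
  fixes E :: "'a::euclidean_space set"
  assumes E: "subspace E" and "dim E \<le> l" "l \<le> DIM('a)"
  obtains F where "subspace F" "dim F = l" "E \<subseteq> F"
proof -
  have "dim (E\<^sup>\<bottom>) + dim E = DIM('a)"
    using dim_Int_orthogonal_comp[OF E subspace_UNIV] by simp
  then have "DIM('a) - l \<le> dim (E\<^sup>\<bottom>)" using assms by simp
  then obtain T where T: "subspace T" "T \<subseteq> span (E\<^sup>\<bottom>)" "dim T = DIM('a) - l"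
    using choose_subspace_of_subspace by metis
  show thesis
  proof (rule that[of "T\<^sup>\<bottom>"])
    show "subspace (T\<^sup>\<bottom>)" by (rule subspace_orthogonal_comp)
    show "dim (T\<^sup>\<bottom>) = l"
      using dim_Int_orthogonal_comp[OF T(1) subspace_UNIV] T(3) assms by simp
    have "T \<subseteq> E\<^sup>\<bottom>" using T(2) by (simp add: span_eq_iff[THEN iffD2, OF subspace_orthogonal_comp])
    then show "E \<subseteq> T\<^sup>\<bottom>"
      using orthogonal_comp_anti_mono orthogonal_comp_subset by blast
  qed
qed

section \<open>The two inequalities for a fixed \<open>F\<close>\<close>

lemma subspace_volume_sum_section_le:
  fixes E F K L :: "'a::euclidean_space set"
  assumes E: "subspace E" and F: "subspace F" and EF: "E \<subseteq> F" and l: "1 \<le> dim F"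
    and K: "convex_body K" and L: "convex_body L"
    and max: "\<And>z. proj_inter_volume F K L z \<le> subspace_volume F (orth_proj F ` (K \<inter> uminus ` L))"
  shows "subspace_volume E ((K + L) \<inter> E)
        \<le> real ((dim F + dim E) choose dim E) *
           (\<integral>x. flat_volume E x (orth_proj F ` K \<inter> (+) x ` E)
               * flat_volume E x (orth_proj F ` (uminus ` L) \<inter> (+) x ` E)
               / maximum_over UNIV (\<lambda>z. proj_inter_volume F K L z)
             \<partial>subspace_lborel (F \<inter> E\<^sup>\<bottom>))"
proof -
  let ?E = "subspace_lborel E" and ?F = "subspace_lborel F" and ?G = "subspace_lborel (F \<inter> E\<^sup>\<bottom>)"
  let ?P = "orth_proj F ` K" and ?Q = "orth_proj F ` L" and ?R = "orth_proj F ` uminus ` L"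
  let ?W = "orth_proj F ` (K \<inter> uminus ` L)"
  have K': "compact K" "convex K" and L': "compact L" "convex L"
    using K L by (auto simp: convex_body_def)
  have cpt: "compact ?P" "compact ?Q" "compact ?R" "compact ?W"
    by (intro compact_orth_proj[OF F] K' L' compact_Int compact_negations)+
  have brl: "?P \<in> sets borel" "?Q \<in> sets borel" "?R \<in> sets borel" "?W \<in> sets borel"
    using cpt by (auto simp: compact_imp_closed)
  define m where "m = subspace_volume F ?W"
  have m_pos: "0 < m"
    using proj_inter_volume_pos[OF F K L] max unfolding m_def by (meson less_le_trans)
  have m: "emeasure ?F ?W = ennreal m"
    using emeasure_subspace_lborel_finite[OF F compact_imp_bounded[OF cpt(4)] brl(4)]
    by (simp add: m_def subspace_volume_def emeasure_eq_ennreal_measure)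
  \<comment> \<open>The normalization says that the maximum is attained at \<open>z = 0\<close>,
    where \<open>z - L\<close> is the reflection of \<open>L\<close>.\<close>
  have maxi: "maximum_over UNIV (\<lambda>z. proj_inter_volume F K L z) = m"
    using maximum_overI[of 0 UNIV "\<lambda>z. proj_inter_volume F K L z"] max
    by (simp add: proj_inter_volume_def m_def)
  define p where "p x = measure ?E ((+) x -` ?P)" for x
  define r where "r x = measure ?E ((+) x -` ?R)" for x
  have p: "emeasure ?E ((+) x -` ?P) = ennreal (p x)" and r: "emeasure ?E ((+) x -` ?R) = ennreal (r x)" for x
    by (simp_all add: p_def r_def emeasure_slice_eq_measure[OF E] cpt)
  have nonneg: "0 \<le> p x" "0 \<le> r x" for x by (simp_all add: p_def r_def)
  have meas [measurable]: "p \<in> borel_measurable borel" "r \<in> borel_measurable borel"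
    using borel_measurable_emeasure_slice[OF E brl(1)] borel_measurable_emeasure_slice[OF E brl(3)]
    unfolding p_def r_def measure_def by measurable
  define I where "I = (\<integral>\<^sup>+x. ennreal (p x) * ennreal (r x) \<partial>?G)"
  have I: "I = (\<integral>\<^sup>+z. emeasure ?F (?P \<inter> (\<lambda>y. z - y) -` ?Q) \<partial>?E)"
    unfolding I_def nn_integral_emeasure_Int_reflected[OF E F EF brl(1,2)]
    by (simp add: p r flip: orth_proj_uminus_image[OF F])
  have I_fin: "I < \<infinity>"
    unfolding I by (rule nn_integral_emeasure_Int_reflected_finite[OF E F cpt(1,2)])
  have bound: "ennreal m * emeasure ?E ((K + L) \<inter> E) \<le> of_nat ((dim F + dim E) choose dim E) * I"
    using emeasure_sum_section_le[OF E F EF l K' L'] m m_pos by (simp add: I)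
  have "(\<integral>x. flat_volume E x (?P \<inter> (+) x ` E) * flat_volume E x (?R \<inter> (+) x ` E)
             / maximum_over UNIV (\<lambda>z. proj_inter_volume F K L z) \<partial>?G)
      = (\<integral>x. p x * r x \<partial>?G) / m"
    by (simp add: maxi flat_volume_eq_measure_slice[OF E] brl p_def r_def)
  also have "(\<integral>x. p x * r x \<partial>?G) = enn2real I"
    unfolding I_def by (subst integral_eq_nn_integral) (auto simp: nonneg ennreal_mult)
  finally have rhs: "(\<integral>x. flat_volume E x (?P \<inter> (+) x ` E) * flat_volume E x (?R \<inter> (+) x ` E)
             / maximum_over UNIV (\<lambda>z. proj_inter_volume F K L z) \<partial>?G) = enn2real I / m" .
  \<comment> \<open>Since \<open>enn2real\<close> sends infinity to 0, monotonicity relies on the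
    right-hand side being finite, which is \<open>I_fin\<close>.\<close>
  have "enn2real (ennreal m * emeasure ?E ((K + L) \<inter> E))
      \<le> enn2real (of_nat ((dim F + dim E) choose dim E) * I)"
    using bound I_fin by (intro enn2real_mono) (simp_all add: ennreal_mult_less_top ennreal_mult_eq_top_iff less_top[symmetric])
  then have "m * subspace_volume E ((K + L) \<inter> E) \<le> real ((dim F + dim E) choose dim E) * enn2real I"
    using m_pos by (simp add: enn2real_mult subspace_volume_def measure_def ennreal_of_nat_eq_real_of_nat)
  then show ?thesis
    unfolding rhs using m_pos by (simp add: field_simps)
qed

text \<open>The argument starts from \<open>emeasure_sum_section_le\<close> and stays in
  \<open>ennreal\<close>, where the volume of the projection of \<open>K\<close>, positive and
  finite, cancels from both sides.\<close>

lemma subspace_volume_difference_section_le: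
  fixes E F K :: "'a::euclidean_space set"
  assumes E: "subspace E" and F: "subspace F" and EF: "E \<subseteq> F" and l: "1 \<le> dim F"
    and K: "convex_body K"
  shows "subspace_volume E ((K + uminus ` K) \<inter> E)
        \<le> real ((dim F + dim E) choose dim E) *
           maximum_over F (\<lambda>x. flat_volume E x (orth_proj F ` K \<inter> (+) x ` E))"
proof -
  let ?E = "subspace_lborel E" and ?F = "subspace_lborel F" and ?G = "subspace_lborel (F \<inter> E\<^sup>\<bottom>)"
  let ?P = "orth_proj F ` K" and ?Q = "orth_proj F ` uminus ` K"
  let ?\<phi> = "\<lambda>x. emeasure ?E ((+) x -` ?P)"
  have "subspace (F \<inter> E\<^sup>\<bottom>)"
    by (intro subspace_inter F subspace_orthogonal_comp)
  then interpret G: invariant_measure ?G "F \<inter> E\<^sup>\<bottom>" by (rule invariant_subspace_lborel)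
  have K': "compact K" "convex K" "interior K \<noteq> {}" and L': "compact (uminus ` K)" "convex (uminus ` K)"
    using K by (auto simp: convex_body_def intro: compact_negations convex_negations)
  have cpt: "compact ?P" "compact ?Q"
    by (intro compact_orth_proj[OF F] K' L')+
  then have brl: "?P \<in> sets borel" "?Q \<in> sets borel"
    by (auto simp: compact_imp_closed)
  have Int: "orth_proj F ` (K \<inter> uminus ` uminus ` K) = ?P"
    by (simp add: image_image)
  have pos: "emeasure ?F ?P \<noteq> 0"
    using emeasure_orth_proj_pos[OF F K'(1,3)] by simp
  have fin: "emeasure ?F ?P < \<infinity>"
    by (rule emeasure_subspace_lborel_finite[OF F compact_imp_bounded[OF cpt(1)] brl(1)])
  obtain x0 where x0: "x0 \<in> F" "\<And>x. x \<in> F \<Longrightarrow> ?\<phi> x \<le> ?\<phi> x0"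
    using slice_volume_attains_max[OF E F EF cpt(1)] orth_proj_mem(1)[OF F] by blast
  have \<phi>: "?\<phi> x = ennreal (measure ?E ((+) x -` ?P))" for x
    by (rule emeasure_slice_eq_measure[OF E cpt(1)])
  have maxi: "maximum_over F (\<lambda>x. flat_volume E x (?P \<inter> (+) x ` E)) = measure ?E ((+) x0 -` ?P)"
    using maximum_overI[of x0 F "\<lambda>x. flat_volume E x (?P \<inter> (+) x ` E)"] x0
    by (simp add: \<phi> flat_volume_eq_measure_slice[OF E brl(1)])
  note [measurable] = borel_measurable_emeasure_slice[OF E brl(1)]
  \<comment> \<open>Reflecting \<open>-K\<close> gives \<open>K\<close> back, so the two slice
    factors are the same function.\<close>
  have "(\<integral>\<^sup>+z. emeasure ?F (?P \<inter> (\<lambda>y. z - y) -` ?Q) \<partial>?E) = (\<integral>\<^sup>+x. ?\<phi> x * ?\<phi> x \<partial>?G)"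
    unfolding nn_integral_emeasure_Int_reflected[OF E F EF brl] orth_proj_uminus_image[OF F, symmetric]
    by (simp add: image_image)
  also have "\<dots> \<le> (\<integral>\<^sup>+x. ?\<phi> x * ?\<phi> x0 \<partial>?G)"
    by (intro nn_integral_mono_AE, use G.AE_mem in eventually_elim) (auto intro!: mult_left_mono x0(2))
  also have "\<dots> = (\<integral>\<^sup>+x. ?\<phi> x \<partial>?G) * ?\<phi> x0"
    by (rule nn_integral_multc) measurable
  also have "(\<integral>\<^sup>+x. ?\<phi> x \<partial>?G) = (\<integral>\<^sup>+x. \<integral>\<^sup>+e. indicator ?P (x + e) \<partial>?E \<partial>?G)"
  proof (rule nn_integral_cong)
    fix x
    have "?\<phi> x = (\<integral>\<^sup>+e. indicator ((+) x -` ?P) e \<partial>?E)" using brl by simp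
    also have "\<dots> = (\<integral>\<^sup>+e. indicator ?P (x + e) \<partial>?E)"
      by (intro nn_integral_cong) (auto simp: indicator_def)
    finally show "?\<phi> x = (\<integral>\<^sup>+e. indicator ?P (x + e) \<partial>?E)" .
  qed
  also have "\<dots> = emeasure ?F ?P"
    using nn_integral_subspace_lborel_decomp[OF E F EF, of "indicator ?P"] brl by simp
  finally have "emeasure ?F ?P * emeasure ?E ((K + uminus ` K) \<inter> E)
      \<le> of_nat ((dim F + dim E) choose dim E) * (emeasure ?F ?P * ?\<phi> x0)"
    using emeasure_sum_section_le[OF E F EF l K'(1,2) L'] pos unfolding Int
    by (meson mult_left_mono order_trans zero_le)
  then have "emeasure ?E ((K + uminus ` K) \<inter> E) * emeasure ?F ?P / emeasure ?F ?P
      \<le> (of_nat ((dim F + dim E) choose dim E) * ?\<phi> x0) * emeasure ?F ?P / emeasure ?F ?P"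
    by (intro divide_right_mono_ennreal) (simp add: mult_ac)
  then have "emeasure ?E ((K + uminus ` K) \<inter> E) \<le> of_nat ((dim F + dim E) choose dim E) * ?\<phi> x0"
    using pos fin by (simp add: mult_divide_eq_ennreal)
  also have "\<dots> = ennreal (real ((dim F + dim E) choose dim E) * measure ?E ((+) x0 -` ?P))"
    by (simp add: \<phi> ennreal_mult ennreal_of_nat_eq_real_of_nat)
  finally have "subspace_volume E ((K + uminus ` K) \<inter> E)
      \<le> real ((dim F + dim E) choose dim E) * measure ?E ((+) x0 -` ?P)"
    unfolding subspace_volume_def measure_def[of ?E "(K + uminus ` K) \<inter> E"]
    by (intro enn2real_leI) auto
  then show ?thesis by (simp only: maxi)
qed

theorem proposition5p1:
  fixes k l :: nat and E K :: "(real ^ 'n) set"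
  assumes "1 \<le> k" "k \<le> l" "l \<le> CARD('n)"
    and "subspace E" "dim E = k"
    and "convex_body K"
  shows
    "(\<forall>F L :: (real ^ 'n) set.
        subspace F \<and> dim F = l \<and> E \<subseteq> F \<and> convex_body L \<and>
        (\<forall>z. proj_inter_volume F K L z
              \<le> subspace_volume F (orth_proj F ` (K \<inter> uminus ` L)))
        \<longrightarrow>
        subspace_volume E ((K + L) \<inter> E)
        \<le> real ((l + k) choose k) *
           (\<integral>x. flat_volume E x (orth_proj F ` K \<inter> (+) x ` E)
               * flat_volume E x (orth_proj F ` (uminus ` L) \<inter> (+) x ` E)
               / maximum_over UNIV (\<lambda>z. proj_inter_volume F K L z)
             \<partial>subspace_lborel (F \<inter> E\<^sup>\<bottom>)))
     \<and>
     subspace_volume E ((K + uminus ` K) \<inter> E)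
     \<le> real ((l + k) choose k) *
        (INF F \<in> {F. subspace F \<and> dim F = l \<and> E \<subseteq> F}.
           maximum_over F (\<lambda>x. flat_volume E x (orth_proj F ` K \<inter> (+) x ` E)))"
proof (intro conjI allI impI; (elim conjE)?)
  fix F L :: "(real ^ 'n) set"
  assume "subspace F" "dim F = l" "E \<subseteq> F" "convex_body L"
    "\<forall>z. proj_inter_volume F K L z \<le> subspace_volume F (orth_proj F ` (K \<inter> uminus ` L))"
  then show "subspace_volume E ((K + L) \<inter> E)
        \<le> real ((l + k) choose k) *
           (\<integral>x. flat_volume E x (orth_proj F ` K \<inter> (+) x ` E)
               * flat_volume E x (orth_proj F ` (uminus ` L) \<inter> (+) x ` E)
               / maximum_over UNIV (\<lambda>z. proj_inter_volume F K L z)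
             \<partial>subspace_lborel (F \<inter> E\<^sup>\<bottom>))"
    using subspace_volume_sum_section_le[of E F K L] assms by auto
next
  let ?\<F> = "{F. subspace F \<and> dim F = l \<and> E \<subseteq> F}"
  let ?b = "real ((l + k) choose k)"
  have "?b > 0" by simp
  obtain F0 where "F0 \<in> ?\<F>"
    using ex_subspace_between_dim[of E l] assms by auto
  \<comment> \<open>Dividing by the binomial coefficient first gives a lower bound independent of
    \<open>F\<close>, to be compared with the real infimum.\<close>
  have "subspace_volume E ((K + uminus ` K) \<inter> E) / ?b
      \<le> (INF F \<in> ?\<F>. maximum_over F (\<lambda>x. flat_volume E x (orth_proj F ` K \<inter> (+) x ` E)))"
  proof (rule cINF_greatest)
    fix F assume "F \<in> ?\<F>"
    then have "subspace_volume E ((K + uminus ` K) \<inter> E)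
        \<le> ?b * maximum_over F (\<lambda>x. flat_volume E x (orth_proj F ` K \<inter> (+) x ` E))"
      using subspace_volume_difference_section_le[of E F K] assms by auto
    then show "subspace_volume E ((K + uminus ` K) \<inter> E) / ?b
        \<le> maximum_over F (\<lambda>x. flat_volume E x (orth_proj F ` K \<inter> (+) x ` E))"
      using \<open>?b > 0\<close> by (simp add: field_simps)
  qed (use \<open>F0 \<in> ?\<F>\<close> in auto)
  then show "subspace_volume E ((K + uminus ` K) \<inter> E)
      \<le> ?b * (INF F \<in> ?\<F>. maximum_over F (\<lambda>x. flat_volume E x (orth_proj F ` K \<inter> (+) x ` E)))"
    using \<open>?b > 0\<close> by (simp add: field_simps)
qed

end
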